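(* In the setting of the context, suppose: (i) there are constants $0<L_1,U_1<\infty$ with $L_1\{\|v_1\|^2_{\mathcal{E}(\Omega)}+\|v_2\|^2_{\mathcal{E}(\Omega)}\}\le|B(v_1+v_2,v_1+v_2)|\le U_1\{\|v_1\|^2_{\mathcal{E}(\Omega)}+\|v_2\|^2_{\mathcal{E}(\Omega)}\}$ for all $v_1\in\mathcal{S}_1$, $v_2\in\overline{\mathcal{S}}_2$; (ii) there are constants $0<L_2,U_2<\infty$ such that for every enriched element $\tau_k$, $L_2\|[D^{(k)}]^{-1}\mathbf{x}\|^2\le\mathbf{x}^TA^{(k)}_{22}\mathbf{x}\le U_2\|[D^{(k)}]^{-1}\mathbf{x}\|^2$ for all $\mathbf{x}\in\mathbb{R}^{\varsigma^{(k)}}$; (iii) there are constants $0<L_3,U_3<\infty$ such that for every $x_i\in\mathcal{T}_2$, $L_3\le(\mathbf{A}_{22})^{-1}_{x_ix_i}\Delta_i\le U_3$, where $(\mathbf{A}_{22})_{x_ix_i}=B(N_i\bar\phi^i,N_i\bar\phi^i)$ is the diagonal entry of $\mathbf{A}_{22}$ associated with $x_i$. Then \[ \frac{L_1}{U_1}\,\mathfrak{K}(\mathbf{A}_{11})\le\mathfrak{K}(\mathbf{A})\le\mathfrak{K}(\mathbf{A}_{11})\,\frac{U_1}{L_1}\,\frac{\max\{1,\,U_2U_3/\lambda_{\max}(\widehat{\mathbf{A}}_{11})\}}{\min\{1,\,L_2L_3/\lambda_{\min}(\widehat{\mathbf{A}}_{11})\}}, \] where $\lambda_{\min}(\widehat{\mathbf{A}}_{11})$,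 $\lambda_{\max}(\widehat{\mathbf{A}}_{11})$ are the smallest and largest eigenvalues of $\widehat{\mathbf{A}}_{11}$.
   Context: $\Omega=(0,1)$, $a\in L^\infty(\Omega)$, $0<\alpha\le a\le\beta$, $B(u,v)=\int_\Omega au'v'\,dx$, $B_\tau(u,v)=\int_\tau au'v'\,dx$, $\|v\|_{\mathcal{E}(\omega)}=(\int_\omega a|v'|^2dx)^{1/2}$. Uniform mesh $x_k=kh$, $h=1/N$, $k=0,\dots,N$, $\mathcal{T}=\{x_0,\dots,x_N\}$, elements $\tau_k=[x_{k-1},x_k]$, $k=1,\dots,N$; hat functions $N_i$ with $N_i(x_j)=\delta_{ij}$; patches $\omega_i=(x_{i-1},x_{i+1})\cap\Omega$ with vertices the mesh points among $x_{i-1},x_i,x_{i+1}$; $I_{\omega_i}w$ is the piecewise linear interpolant of $w$ on $\omega_i$ at its vertices. For each $x_i$, a function $\phi^i\in H^1(\omega_i)$ is given and $\bar\phi^i=\phi^i-I_{\omega_i}\phi^i$; $\mathcal{T}_2=\{x_i:\bar\phi^i\not\equiv0\}$, $\zeta_2=\mathrm{card}\,\mathcal{T}_2$; $\mathcal{T}_1=\{x_1,\dots,x_N\}$, $\zeta_1=N$. $\mathcal{S}_1=\mathrm{span}\{N_i\}_{x_i\in\mathcal{T}_1}$, $\overline{\mathcal{S}}_2=\mathrm{span}\{N_i\bar\phi^i\}_{x_i\in\mathcal{T}_2}$ (extended by zero). $\mathbf{A}$ is the stiffness matrix of $B$ for the basis $\{N_i\}_{x_i\in\mathcal{T}_1}$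 followed by $\{N_i\bar\phi^i\}_{x_i\in\mathcal{T}_2}$, with diagonal blocks $\mathbf{A}_{11}=\{B(N_i,N_j)\}_{\mathcal{T}_1}$, $\mathbf{A}_{22}=\{B(N_i\bar\phi^i,N_j\bar\phi^j)\}_{\mathcal{T}_2}$. Scaled condition number: for a symmetric positive definite $\mathbf{M}$ with diagonal $\mathbf{D}_\mathbf{M}$, $\widehat{\mathbf{M}}=\mathbf{D}_\mathbf{M}^{-1/2}\mathbf{M}\mathbf{D}_\mathbf{M}^{-1/2}$ (unit diagonal) and $\mathfrak{K}(\mathbf{M})=\lambda_{\max}(\widehat{\mathbf{M}})/\lambda_{\min}(\widehat{\mathbf{M}})$; in particular $\widehat{\mathbf{A}}_{11}$ is $\mathbf{A}_{11}$ scaled by its diagonal. Element matrices: for $k=1,\dots,N$ and $i,j\in\{1,2\}$ let $b^{(k)}_{ij}=B_{\tau_k}(N_{k-2+i}\bar\phi^{k-2+i},N_{k-2+j}\bar\phi^{k-2+j})$, where a term with $x_{k-2+i}\notin\mathcal{T}_2$ (or $\bar\phi^{k-2+i}\equiv0$ on $\tau_k$) is taken as $0$. The element $\tau_k$ is enriched if $b^{(k)}_{11}>0$ or $b^{(k)}_{22}>0$ (equivalently, $x_{k-1}\in\mathcal{T}_2$ with $\bar\phi^{k-1}|_{\tau_k}\not\equiv0$, or $x_k\in\mathcal{T}_2$ with $\bar\phi^k|_{\tau_k}\not\equiv0$). The local vertex $x^{(k)}_l:=x_{k-2+l}$ ($l=1,2$) is associated with $\tau_k$'s matrix if $b^{(k)}_{ll}>0$;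 $\varsigma^{(k)}\in\{1,2\}$ is the number of associated vertices and $A^{(k)}_{22}$ is the $\varsigma^{(k)}\times\varsigma^{(k)}$ submatrix of $(b^{(k)}_{ij})$ on the associated indices. If $\varsigma^{(k)}=2$, $D^{(k)}=\mathrm{diag}\{\delta^{(k)}_1,\delta^{(k)}_2\}$ with given positive numbers $\delta^{(k)}_1,\delta^{(k)}_2$; if only the local index $l$ is associated, $D^{(k)}=[\delta^{(k)}_l]$ with $\delta^{(k)}_l=(b^{(k)}_{ll})^{-1/2}$. For $x_i\in\mathcal{T}_2$: $\mathcal{K}^*_i$ is the set of enriched elements $\tau_k\subset\overline{\omega}_i$ with $\bar\phi^i|_{\tau_k}\not\equiv0$; $l(i,k)\in\{1,2\}$ is the local index with $x^{(k)}_{l(i,k)}=x_i$ (i.e. $l(i,i)=2$, $l(i,i+1)=1$); and $\Delta_i=\sum_{\tau_k\in\mathcal{K}^*_i}[\delta^{(k)}_{l(i,k)}]^{-2}$. *)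

theory Defs
  imports "HOL-Analysis.Analysis" "Jordan_Normal_Form.Char_Poly"
begin

definition node :: "nat \<Rightarrow> nat \<Rightarrow> real" where
  "node N k = real k / real N"

definition hatf :: "nat \<Rightarrow> nat \<Rightarrow> real \<Rightarrow> real" where
  "hatf N i x = max 0 (1 - real N * \<bar>x - node N i\<bar>)"

definition dhat :: "nat \<Rightarrow> nat \<Rightarrow> real \<Rightarrow> real" where
  "dhat N i x = (if 1 \<le> i \<and> node N (i - 1) < x \<and> x < node N i then real N
                 else if i < N \<and> node N i < x \<and> x < node N (i + 1) then - real N
                 else 0)"

text \<open>Patch omega_i = (lo, hi) = (x_{i-1}, x_{i+1}) intersected with (0,1).\<close>
definition lo :: "nat \<Rightarrow> nat \<Rightarrow> real" where
  "lo N i = node N (i - 1)"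

definition hi :: "nat \<Rightarrow> nat \<Rightarrow> real" where
  "hi N i = node N (min N (i + 1))"

text \<open>Piecewise linear interpolant of f on omega_i at its vertices (valid on [lo,hi]).\<close>
definition interp :: "nat \<Rightarrow> (real \<Rightarrow> real) \<Rightarrow> nat \<Rightarrow> real \<Rightarrow> real" where
  "interp N f i x =
     (if x \<le> node N i then
        (if i = 0 then f (node N 0)
         else f (node N (i - 1)) + (f (node N i) - f (node N (i - 1))) * real N * (x - node N (i - 1)))
      else f (node N i) + (f (node N (i + 1)) - f (node N i)) * real N * (x - node N i))"

definition phibar :: "nat \<Rightarrow> (nat \<Rightarrow> real \<Rightarrow> real) \<Rightarrow> nat \<Rightarrow> real \<Rightarrow> real" where
  "phibar N \<phi> i x = (if lo N i \<le> x \<and> x \<le> hi N i then \<phi> i x - interp N (\<phi> i) i x else 0)"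

text \<open>(a.e.) derivative of phibar^i, where d\<phi> i is the weak derivative of \<phi> i.\<close>
definition dphibar :: "nat \<Rightarrow> (nat \<Rightarrow> real \<Rightarrow> real) \<Rightarrow> (nat \<Rightarrow> real \<Rightarrow> real) \<Rightarrow> nat \<Rightarrow> real \<Rightarrow> real" where
  "dphibar N \<phi> d\<phi> i x =
     (if 1 \<le> i \<and> node N (i - 1) < x \<and> x < node N i
        then d\<phi> i x - real N * (\<phi> i (node N i) - \<phi> i (node N (i - 1)))
      else if i < N \<and> node N i < x \<and> x < node N (i + 1)
        then d\<phi> i x - real N * (\<phi> i (node N (i + 1)) - \<phi> i (node N i))
      else 0)"

definition denr :: "nat \<Rightarrow> (nat \<Rightarrow> real \<Rightarrow> real) \<Rightarrow> (nat \<Rightarrow> real \<Rightarrow> real) \<Rightarrow> nat \<Rightarrow> real \<Rightarrow> real" where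
  "denr N \<phi> d\<phi> i x = dhat N i x * phibar N \<phi> i x + hatf N i x * dphibar N \<phi> d\<phi> i x"

text \<open>Bilinear forms B and B_tau_k, expressed through the derivatives u', v'.\<close>
definition Bf :: "(real \<Rightarrow> real) \<Rightarrow> (real \<Rightarrow> real) \<Rightarrow> (real \<Rightarrow> real) \<Rightarrow> real" where
  "Bf a du dv = integral {0..1} (\<lambda>x. a x * du x * dv x)"

definition BT :: "nat \<Rightarrow> (real \<Rightarrow> real) \<Rightarrow> nat \<Rightarrow> (real \<Rightarrow> real) \<Rightarrow> (real \<Rightarrow> real) \<Rightarrow> real" where
  "BT N a k du dv = integral {node N (k - 1)..node N k} (\<lambda>x. a x * du x * dv x)"

text \<open>phi^i in H^1(omega_i): absolutely continuous representative with L^2 derivative d\<phi> i.\<close>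
definition H1_patch :: "nat \<Rightarrow> (nat \<Rightarrow> real \<Rightarrow> real) \<Rightarrow> (nat \<Rightarrow> real \<Rightarrow> real) \<Rightarrow> nat \<Rightarrow> bool" where
  "H1_patch N \<phi> d\<phi> i \<longleftrightarrow>
     d\<phi> i absolutely_integrable_on {lo N i..hi N i} \<and>
     (\<lambda>x. (d\<phi> i x)\<^sup>2) integrable_on {lo N i..hi N i} \<and>
     (\<forall>x\<in>{lo N i..hi N i}. \<phi> i x = \<phi> i (lo N i) + integral {lo N i..x} (d\<phi> i))"

definition T2 :: "nat \<Rightarrow> (nat \<Rightarrow> real \<Rightarrow> real) \<Rightarrow> nat set" where
  "T2 N \<phi> = {i. i \<le> N \<and> (\<exists>x. lo N i < x \<and> x < hi N i \<and> phibar N \<phi> i x \<noteq> 0)}"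

definition nz :: "nat \<Rightarrow> (nat \<Rightarrow> real \<Rightarrow> real) \<Rightarrow> nat \<Rightarrow> nat \<Rightarrow> bool" where
  "nz N \<phi> k j \<longleftrightarrow> j \<in> T2 N \<phi> \<and>
      (\<exists>x. node N (k - 1) < x \<and> x < node N k \<and> phibar N \<phi> j x \<noteq> 0)"

text \<open>Element matrix entries b^(k)_{lm}, l,m in {1,2}; local vertex l is node k+l-2.\<close>
definition belem :: "nat \<Rightarrow> (real \<Rightarrow> real) \<Rightarrow> (nat \<Rightarrow> real \<Rightarrow> real) \<Rightarrow> (nat \<Rightarrow> real \<Rightarrow> real)
                     \<Rightarrow> nat \<Rightarrow> nat \<Rightarrow> nat \<Rightarrow> real" where
  "belem N a \<phi> d\<phi> k l m =
     (if nz N \<phi> k (k + l - 2) \<and> nz N \<phi> k (k + m - 2)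
      then BT N a k (denr N \<phi> d\<phi> (k + l - 2)) (denr N \<phi> d\<phi> (k + m - 2)) else 0)"

definition enriched :: "nat \<Rightarrow> (real \<Rightarrow> real) \<Rightarrow> (nat \<Rightarrow> real \<Rightarrow> real) \<Rightarrow> (nat \<Rightarrow> real \<Rightarrow> real) \<Rightarrow> nat \<Rightarrow> bool" where
  "enriched N a \<phi> d\<phi> k \<longleftrightarrow> belem N a \<phi> d\<phi> k 1 1 > 0 \<or> belem N a \<phi> d\<phi> k 2 2 > 0"

text \<open>Set of associated local indices of tau_k (its cardinality is varsigma^(k)).\<close>
definition assoc :: "nat \<Rightarrow> (real \<Rightarrow> real) \<Rightarrow> (nat \<Rightarrow> real \<Rightarrow> real) \<Rightarrow> (nat \<Rightarrow> real \<Rightarrow> real) \<Rightarrow> nat \<Rightarrow> nat set" where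
  "assoc N a \<phi> d\<phi> k = {l \<in> {1, 2}. belem N a \<phi> d\<phi> k l l > 0}"

definition Kstar :: "nat \<Rightarrow> (real \<Rightarrow> real) \<Rightarrow> (nat \<Rightarrow> real \<Rightarrow> real) \<Rightarrow> (nat \<Rightarrow> real \<Rightarrow> real) \<Rightarrow> nat \<Rightarrow> nat set" where
  "Kstar N a \<phi> d\<phi> i = {k \<in> {i, i + 1}. 1 \<le> k \<and> k \<le> N \<and> enriched N a \<phi> d\<phi> k \<and>
       (\<exists>x. node N (k - 1) < x \<and> x < node N k \<and> phibar N \<phi> i x \<noteq> 0)}"

definition lidx :: "nat \<Rightarrow> nat \<Rightarrow> nat" where
  "lidx i k = (if k = i then 2 else 1)"

definition Delta :: "nat \<Rightarrow> (real \<Rightarrow> real) \<Rightarrow> (nat \<Rightarrow> real \<Rightarrow> real) \<Rightarrow> (nat \<Rightarrow> real \<Rightarrow> real)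
                     \<Rightarrow> (nat \<Rightarrow> nat \<Rightarrow> real) \<Rightarrow> nat \<Rightarrow> real" where
  "Delta N a \<phi> d\<phi> \<delta> i = (\<Sum>k\<in>Kstar N a \<phi> d\<phi> i. 1 / (\<delta> k (lidx i k))\<^sup>2)"

text \<open>Global stiffness matrices. Basis order: N_1..N_N, then N_i phibar^i for x_i in T_2 (increasing i).\<close>
definition basisd :: "nat \<Rightarrow> (nat \<Rightarrow> real \<Rightarrow> real) \<Rightarrow> (nat \<Rightarrow> real \<Rightarrow> real) \<Rightarrow> nat \<Rightarrow> real \<Rightarrow> real" where
  "basisd N \<phi> d\<phi> p = (if p < N then dhat N (p + 1)
                        else denr N \<phi> d\<phi> (sorted_list_of_set (T2 N \<phi>) ! (p - N)))"

definition Amat :: "nat \<Rightarrow> (real \<Rightarrow> real) \<Rightarrow> (nat \<Rightarrow> real \<Rightarrow> real) \<Rightarrow> (nat \<Rightarrow> real \<Rightarrow> real) \<Rightarrow> real mat" where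
  "Amat N a \<phi> d\<phi> = mat (N + card (T2 N \<phi>)) (N + card (T2 N \<phi>))
      (\<lambda>(p, q). Bf a (basisd N \<phi> d\<phi> p) (basisd N \<phi> d\<phi> q))"

definition A11 :: "nat \<Rightarrow> (real \<Rightarrow> real) \<Rightarrow> real mat" where
  "A11 N a = mat N N (\<lambda>(p, q). Bf a (dhat N (p + 1)) (dhat N (q + 1)))"

definition scaled :: "real mat \<Rightarrow> real mat" where
  "scaled M = (let D = mat (dim_row M) (dim_row M)
                        (\<lambda>(i, j). if i = j then 1 / sqrt (M $$ (i, i)) else 0)
               in D * M * D)"

definition lam_max :: "real mat \<Rightarrow> real" where
  "lam_max M = Max {k. eigenvalue M k}"

definition lam_min :: "real mat \<Rightarrow> real" where
  "lam_min M = Min {k. eigenvalue M k}"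

definition kappa :: "real mat \<Rightarrow> real" where
  "kappa M = lam_max (scaled M) / lam_min (scaled M)"

end

(* Write v = v1 + v2 with v1 in S_1 and v2 in the enrichment space. The stable splitting (i) reduces
   the Rayleigh quotient of the scaled stiffness matrix to the energies of v1 and v2. The first is the
   quadratic form of the scaled A11. The second is a sum of element contributions, which (ii) compares
   with the sum of y_i^2 Delta_i over T_2; in the scaled variables y_i = x_i / sqrt (A22)_ii this is
   comparable to the sum of x_i^2 by (iii). The delicate point is that Delta_i must collect exactly the
   elements where N_i phibar^i has positive energy: on an element, N_i phibar^i has zero energy iff
   phibar^i vanishes there. *)
theory Submission
  imports Defs
begin

section \<open>Extreme eigenvalues as extrema of the quadratic form\<close>

text \<open>The matrix entries are Henstock-Kurzweil integrals of derivatives that are determined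
  only almost everywhere, and \<open>integral\<close> returns 0 for a function that is not
  integrable. Every product of derivatives must therefore be shown integrable before energies can be
  added over elements or expanded in a basis. The same weak notion of derivative is the obstacle in
  the zero-energy criterion: it links an almost-everywhere statement about \<open>denr\<close> with
  a pointwise statement about \<open>phibar\<close>. The lower bound on the condition number comes
  from testing the large matrix with extremal vectors of the scaled A11, padded with zeros; the
  splitting constants then produce the factor L1/U1. The max and min in the upper bound arise from
  comparing the two diagonal blocks: the larger of the upper block bounds and the smaller of the
  lower ones, with the extreme eigenvalue of the scaled A11 factored out.\<close>

definition qform :: "real mat \<Rightarrow> (nat \<Rightarrow> real) \<Rightarrow> real" where
  "qform M x = (\<Sum>i<dim_row M. \<Sum>j<dim_row M. x i * M $$ (i, j) * x j)"

definition sqsum :: "nat \<Rightarrow> (nat \<Rightarrow> real) \<Rightarrow> real" where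
  "sqsum n x = (\<Sum>i<n. (x i)\<^sup>2)"

lemma sqsum_nonneg: "0 \<le> sqsum n x"
  by (simp add: sqsum_def sum_nonneg)

lemma sqsum_eq_0_iff: "sqsum n x = 0 \<longleftrightarrow> (\<forall>i<n. x i = 0)"
  by (auto simp: sqsum_def sum_nonneg_eq_0_iff)

lemma mult_mat_vec_index_sum:
  assumes "M \<in> carrier_mat n n" "i < n"
  shows "(M *\<^sub>v Matrix.vec n x) $ i = (\<Sum>j<n. M $$ (i, j) * x j)"
  using assms by (auto simp: scalar_prod_def lessThan_atLeast0 intro!: sum.cong)

lemma eigenvalue_imp_qform:
  assumes M: "M \<in> carrier_mat n n" and k: "eigenvalue M k"
  obtains x where "sqsum n x > 0" "qform M x = k * sqsum n x"
proof -
  obtain v where v: "v \<in> carrier_vec n" "v \<noteq> 0\<^sub>v n" "M *\<^sub>v v = k \<cdot>\<^sub>v v"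
    using k M unfolding eigenvalue_def eigenvector_def by auto
  define x where "x i = v $ i" for i
  have vx: "v = Matrix.vec n x" using v(1) unfolding x_def by auto
  have row: "(\<Sum>j<n. M $$ (i, j) * x j) = k * x i" if "i < n" for i
  proof -
    have "(\<Sum>j<n. M $$ (i, j) * x j) = (M *\<^sub>v v) $ i"
      unfolding vx using mult_mat_vec_index_sum[OF M that] by simp
    also have "\<dots> = k * x i" using v that by (simp add: x_def)
    finally show ?thesis .
  qed
  have "sqsum n x \<noteq> 0"
    using v(2) unfolding sqsum_eq_0_iff vx by (auto simp: vec_eq_iff)
  then have "sqsum n x > 0" using sqsum_nonneg[of n x] by linarith
  moreover have "qform M x = k * sqsum n x"
  proof -
    have "qform M x = (\<Sum>i<n. x i * (\<Sum>j<n. M $$ (i, j) * x j))"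
      using M by (simp add: qform_def sum_distrib_left mult.assoc)
    also have "\<dots> = (\<Sum>i<n. x i * (k * x i))"
      using row by (intro sum.cong) auto
    also have "\<dots> = k * sqsum n x"
      by (simp add: sqsum_def sum_distrib_left power2_eq_square mult_ac)
    finally show ?thesis .
  qed
  ultimately show ?thesis using that by blast
qed

lemma eigenvalueI_sum:
  assumes M: "M \<in> carrier_mat n n" and i: "i < n" "x i \<noteq> 0"
    and row: "\<And>i. i < n \<Longrightarrow> (\<Sum>j<n. M $$ (i, j) * x j) = k * x i"
  shows "eigenvalue M k"
  unfolding eigenvalue_def eigenvector_def
proof (intro exI conjI)
  let ?v = "Matrix.vec n x"
  show "?v \<in> carrier_vec (dim_row M)" using M by simp
  show "?v \<noteq> 0\<^sub>v (dim_row M)" using M i by (auto simp: vec_eq_iff)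
  show "M *\<^sub>v ?v = k \<cdot>\<^sub>v ?v"
  proof (rule eq_vecI)
    show "dim_vec (M *\<^sub>v ?v) = dim_vec (k \<cdot>\<^sub>v ?v)" using M by simp
    fix j assume "j < dim_vec (k \<cdot>\<^sub>v ?v)"
    then have j: "j < n" by simp
    show "(M *\<^sub>v ?v) $ j = (k \<cdot>\<^sub>v ?v) $ j"
      using mult_mat_vec_index_sum[OF M j] row[OF j] j by simp
  qed
qed

lemma qform_cong:
  assumes "\<And>i. i < dim_row M \<Longrightarrow> x i = y i"
  shows "qform M x = qform M y"
  unfolding qform_def using assms by (intro sum.cong) auto

text \<open>This exact second-order expansion in t replaces differentiation of the Rayleigh
  quotient: its linear coefficient pairs y with M x, the vector that the eigenvalue equation is
  about.\<close>

lemma qform_add_scale: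
  assumes M: "M \<in> carrier_mat n n" and sym: "\<And>i j. i < n \<Longrightarrow> j < n \<Longrightarrow> M $$ (i, j) = M $$ (j, i)"
  shows "qform M (\<lambda>i. x i + t * y i)
    = qform M x + 2 * t * (\<Sum>i<n. y i * (\<Sum>j<n. M $$ (i, j) * x j)) + t\<^sup>2 * qform M y"
proof -
  have sw: "(\<Sum>i<n. \<Sum>j<n. x i * M $$ (i, j) * y j) = (\<Sum>i<n. \<Sum>j<n. y i * M $$ (i, j) * x j)"
    by (subst sum.swap) (intro sum.cong, auto simp: sym mult_ac)
  have "qform M (\<lambda>i. x i + t * y i)
     = (\<Sum>i<n. \<Sum>j<n. x i * M $$ (i, j) * x j + t * (x i * M $$ (i, j) * y j)
        + t * (y i * M $$ (i, j) * x j) + t\<^sup>2 * (y i * M $$ (i, j) * y j))"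
    using M by (simp add: qform_def algebra_simps power2_eq_square)
  also have "\<dots> = qform M x + t * (\<Sum>i<n. \<Sum>j<n. x i * M $$ (i, j) * y j)
     + t * (\<Sum>i<n. \<Sum>j<n. y i * M $$ (i, j) * x j) + t\<^sup>2 * qform M y"
    using M by (simp add: sum.distrib sum_distrib_left[symmetric] qform_def)
  also have "\<dots> = qform M x + 2 * t * (\<Sum>i<n. \<Sum>j<n. y i * M $$ (i, j) * x j) + t\<^sup>2 * qform M y"
    using sw by simp
  also have "(\<Sum>i<n. \<Sum>j<n. y i * M $$ (i, j) * x j) = (\<Sum>i<n. y i * (\<Sum>j<n. M $$ (i, j) * x j))"
    by (simp add: sum_distrib_left mult.assoc)
  finally show ?thesis .
qed

lemma qform_scale: "qform M (\<lambda>i. c * x i) = c\<^sup>2 * qform M x"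
  by (simp add: qform_def sum_distrib_left power2_eq_square mult_ac)

lemma sqsum_scale: "sqsum n (\<lambda>i. c * x i) = c\<^sup>2 * sqsum n x"
  by (simp add: sqsum_def sum_distrib_left power_mult_distrib)

text \<open>The dimension n is a variable, so vectors are functions on \<open>nat\<close> padded
  with zeros and the unit sphere lives in the product topology. It is a closed subset of a product
  of intervals [-1,1] and singletons {0}, which is compact by Tychonoff; the padding keeps the
  factors beyond n compact.\<close>

lemma compact_sphere_fun:
  "compact {x :: nat \<Rightarrow> real. (\<forall>i\<ge>n. x i = 0) \<and> sqsum n x = 1}"
proof -
  let ?B = "PiE UNIV (\<lambda>i::nat. if i < n then {-1..1::real} else {0})"
  have "compactin (product_topology (\<lambda>i. euclidean) UNIV) ?B"
    by (subst compactin_PiE) auto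
  then have B: "compact ?B"
    by (simp add: euclidean_product_topology[symmetric] compactin_euclidean_iff[symmetric] del: compactin_euclidean_iff)
  have cl: "closed {x :: nat \<Rightarrow> real. sqsum n x = 1}"
    unfolding sqsum_def
    by (intro closed_Collect_eq continuous_on_sum continuous_on_power continuous_on_const
        continuous_on_product_coordinates)
  have eq: "{x :: nat \<Rightarrow> real. (\<forall>i\<ge>n. x i = 0) \<and> sqsum n x = 1} = ?B \<inter> {x. sqsum n x = 1}"
  proof -
    have "x i \<le> 1 \<and> -1 \<le> x i" if "sqsum n x = 1" "i < n" for x :: "nat \<Rightarrow> real" and i
    proof -
      have "(x i)\<^sup>2 \<le> sqsum n x" unfolding sqsum_def
        using that by (intro member_le_sum) auto
      then have "\<bar>x i\<bar> \<le> 1" using that by (simp add: abs_square_le_1)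
      then show ?thesis by linarith
    qed
    then show ?thesis by (fastforce simp: PiE_iff not_less split: if_splits)
  qed
  show ?thesis unfolding eq using B cl by (rule compact_Int_closed)
qed

text \<open>Compactness yields a maximizer of the form on the unit sphere. Its first variation in
  every coordinate direction vanishes, which is the eigenvalue equation row by row.\<close>

lemma qform_max_eigenvalue:
  assumes M: "M \<in> carrier_mat n n" and n: "n > 0"
    and sym: "\<And>i j. i < n \<Longrightarrow> j < n \<Longrightarrow> M $$ (i, j) = M $$ (j, i)"
  obtains k where "eigenvalue M k" "\<And>x. qform M x \<le> k * sqsum n x"
proof -
  let ?S = "{x :: nat \<Rightarrow> real. (\<forall>i\<ge>n. x i = 0) \<and> sqsum n x = 1}"
  have "sqsum n (\<lambda>i. if i = 0 then 1 else 0) = (\<Sum>i<n. if i = 0 then 1 else 0)"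
    unfolding sqsum_def by (intro sum.cong) auto
  then have "(\<lambda>i. if i = 0 then 1 else 0) \<in> ?S" using n by simp
  then have ne: "?S \<noteq> {}" by (metis (lifting) empty_iff)
  have cont: "continuous_on ?S (qform M)"
  proof -
    have coord: "continuous_on ?S (\<lambda>x. x i)" for i
      using continuous_on_product_coordinates by (rule continuous_on_subset) simp
    show ?thesis
      unfolding qform_def
      by (rule continuous_on_sum, rule continuous_on_sum, rule continuous_on_mult[OF _ coord],
          rule continuous_on_mult[OF coord continuous_on_const])
  qed
  obtain x0 where x0: "x0 \<in> ?S" "\<And>x. x \<in> ?S \<Longrightarrow> qform M x \<le> qform M x0"
    using continuous_attains_sup[OF compact_sphere_fun ne cont] by blast
  define k where "k = qform M x0"
  have s0: "sqsum n x0 = 1" using x0 by simp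
  have bound: "qform M x \<le> k * sqsum n x" for x
  proof (cases "sqsum n x = 0")
    case True
    then have "qform M x = 0" using M by (simp add: qform_def sqsum_eq_0_iff)
    then show ?thesis using True by simp
  next
    case False
    then have pos: "sqsum n x > 0" using sqsum_nonneg[of n x] by linarith
    define c where "c = 1 / sqrt (sqsum n x)"
    \<comment> \<open>Besides normalizing x, \<open>y\<close> drops the entries beyond n, as
      membership in the sphere requires; \<open>qform\<close> and \<open>sqsum\<close> do not see
      those entries.\<close>
    define y where "y i = (if i < n then c * x i else 0)" for i
    have c2: "c\<^sup>2 * sqsum n x = 1" using pos by (simp add: c_def power_divide)
    have "sqsum n y = sqsum n (\<lambda>i. c * x i)" unfolding sqsum_def y_def by (intro sum.cong) auto
    then have "sqsum n y = 1" using c2 by (simp add: sqsum_scale)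
    then have "y \<in> ?S" by (simp add: y_def)
    then have "qform M y \<le> k" using x0 by (simp add: k_def)
    moreover have "qform M y = c\<^sup>2 * qform M x"
      using qform_cong[of M y "\<lambda>i. c * x i"] M by (simp add: y_def qform_scale)
    ultimately have "c\<^sup>2 * qform M x * sqsum n x \<le> k * sqsum n x"
      using pos by (simp add: mult_right_mono)
    then show ?thesis using c2 by (simp add: algebra_simps)
  qed
  have row: "(\<Sum>j<n. M $$ (i, j) * x0 j) = k * x0 i" if i: "i < n" for i
  proof -
    \<comment> \<open>The test direction is the i-th unit vector, so the linear coefficient of the
      expansion is the i-th entry of M x0.\<close>
    define y :: "nat \<Rightarrow> real" where "y = (\<lambda>j. if j = i then 1 else 0)"
    define r where "r = (\<Sum>j<n. M $$ (i, j) * x0 j)"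
    have yr: "(\<Sum>l<n. y l * (\<Sum>j<n. M $$ (l, j) * x0 j)) = r"
      using i unfolding y_def r_def by (simp add: sum.delta if_distrib[of "\<lambda>t. t * _"] cong: if_cong)
    have sq: "sqsum n (\<lambda>j. x0 j + t * y j) = 1 + 2 * t * x0 i + t\<^sup>2" for t
    proof -
      have "sqsum n (\<lambda>j. x0 j + t * y j)
        = (\<Sum>j<n. (x0 j)\<^sup>2 + (if j = i then 2 * t * x0 i + t\<^sup>2 else 0))"
        unfolding sqsum_def y_def
        by (intro sum.cong) (auto simp: power2_eq_square algebra_simps)
      also have "\<dots> = sqsum n x0 + (2 * t * x0 i + t\<^sup>2)"
        using i by (simp add: sum.distrib sqsum_def)
      finally show ?thesis using s0 by simp
    qed
    have ineq: "2 * t * (r - k * x0 i) \<le> t\<^sup>2 * (k - qform M y)" for t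
      using bound[of "\<lambda>j. x0 j + t * y j"] qform_add_scale[OF M sym, of x0 t y] sq[of t]
      unfolding yr k_def[symmetric] by (simp add: algebra_simps)
    \<comment> \<open>\<open>A\<close> is the i-th residual of the eigenvalue equation. At t = A/C
      the linear term is 2 A^2/C and the quadratic term is at most A^2/C, which forces A = 0; the
      added 1 keeps \<open>C\<close> positive.\<close>
    define A where "A = r - k * x0 i"
    define C where "C = \<bar>k - qform M y\<bar> + 1"
    have C: "C > 0" by (simp add: C_def)
    have "2 * (A / C) * A \<le> (A / C)\<^sup>2 * (k - qform M y)"
      using ineq[of "A / C"] by (simp add: A_def)
    also have "\<dots> \<le> (A / C)\<^sup>2 * C"
      by (intro mult_left_mono) (auto simp: C_def)
    also have "\<dots> = (A / C) * A" using C by (simp add: power2_eq_square)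
    finally have "A * A / C \<le> 0" by simp
    then have "A * A \<le> 0" using C by (simp add: divide_le_0_iff)
    then have "A = 0" by (auto simp: mult_le_0_iff)
    then show ?thesis by (simp add: A_def r_def)
  qed
  have "sqsum n x0 \<noteq> 0" using s0 by simp
  then obtain i where "i < n" "x0 i \<noteq> 0" unfolding sqsum_eq_0_iff by blast
  then have "eigenvalue M k" using eigenvalueI_sum[OF M _ _ row] by blast
  then show ?thesis using bound that by blast
qed

lemma qform_min_eigenvalue:
  assumes M: "M \<in> carrier_mat n n" and n: "n > 0"
    and sym: "\<And>i j. i < n \<Longrightarrow> j < n \<Longrightarrow> M $$ (i, j) = M $$ (j, i)"
  obtains k where "eigenvalue M k" "\<And>x. k * sqsum n x \<le> qform M x"
proof -
  have mM: "- M \<in> carrier_mat n n" using M by simp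
  have symm: "(- M) $$ (i, j) = (- M) $$ (j, i)" if "i < n" "j < n" for i j
    using sym that M by simp
  have neg: "qform (- M) x = - qform M x" for x
    using M by (auto simp: qform_def sum_negf[symmetric] intro!: sum.cong)
  obtain k where k: "eigenvalue (- M) k" "\<And>x. qform (- M) x \<le> k * sqsum n x"
    by (rule qform_max_eigenvalue[OF mM n symm]) auto
  obtain v where v: "v \<in> carrier_vec n" "v \<noteq> 0\<^sub>v n" "(- M) *\<^sub>v v = k \<cdot>\<^sub>v v"
    using k(1) M unfolding eigenvalue_def eigenvector_def by auto
  have "M *\<^sub>v v = (- k) \<cdot>\<^sub>v v"
  proof (rule eq_vecI)
    show "dim_vec (M *\<^sub>v v) = dim_vec ((- k) \<cdot>\<^sub>v v)" using M v by simp
    fix i assume "i < dim_vec ((- k) \<cdot>\<^sub>v v)"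
    then have i: "i < n" using v by simp
    have "((- M) *\<^sub>v v) $ i = - ((M *\<^sub>v v) $ i)"
      using i M v(1) by (simp add: scalar_prod_def sum_negf)
    then show "(M *\<^sub>v v) $ i = ((- k) \<cdot>\<^sub>v v) $ i"
      using i v by simp
  qed
  then have "eigenvalue M (- k)" using v M unfolding eigenvalue_def eigenvector_def by auto
  moreover have "- k * sqsum n x \<le> qform M x" for x
    using k(2)[of x] neg[of x] by simp
  ultimately show ?thesis using that by blast
qed

text \<open>Eigenvalues are roots of the monic, hence nonzero, characteristic polynomial. Finiteness
  gives \<open>Max\<close> and \<open>Min\<close> in \<open>lam_max\<close> and
  \<open>lam_min\<close> their intended meaning.\<close>

lemma finite_eigenvalues:
  fixes M :: "real mat"
  assumes M: "M \<in> carrier_mat n n"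
  shows "finite {k. eigenvalue M k}"
proof -
  have "char_poly M \<noteq> 0" using degree_monic_char_poly[OF M] by auto
  then show ?thesis
    using poly_roots_finite by (simp add: eigenvalue_root_char_poly[OF M])
qed

text \<open>Each eigenvalue is the Rayleigh quotient of its eigenvector, so none exceeds the maximum
  of the quotient, which is itself an eigenvalue. With attainment available, an estimate of
  \<open>lam_max\<close> reduces to an inequality at a single vector.\<close>

theorem Rayleigh_max:
  assumes M: "M \<in> carrier_mat n n" and n: "n > 0"
    and sym: "\<And>i j. i < n \<Longrightarrow> j < n \<Longrightarrow> M $$ (i, j) = M $$ (j, i)"
  shows "qform M x \<le> lam_max M * sqsum n x"
    and "\<exists>x. sqsum n x > 0 \<and> qform M x = lam_max M * sqsum n x"
proof -
  obtain k where k: "eigenvalue M k" "\<And>x. qform M x \<le> k * sqsum n x"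
    by (rule qform_max_eigenvalue[OF M n sym]) auto
  have "lam_max M = k"
    unfolding lam_max_def
  proof (rule Max_eqI[OF finite_eigenvalues[OF M]])
    show "k \<in> {k. eigenvalue M k}" using k by simp
    fix l assume "l \<in> {k. eigenvalue M k}"
    then obtain x where "sqsum n x > 0" "qform M x = l * sqsum n x"
      using eigenvalue_imp_qform[OF M] by auto
    then show "l \<le> k" using k(2)[of x] by simp
  qed
  then show "qform M x \<le> lam_max M * sqsum n x"
    and "\<exists>x. sqsum n x > 0 \<and> qform M x = lam_max M * sqsum n x"
    using k eigenvalue_imp_qform[OF M k(1)] by auto
qed

theorem Rayleigh_min:
  assumes M: "M \<in> carrier_mat n n" and n: "n > 0"
    and sym: "\<And>i j. i < n \<Longrightarrow> j < n \<Longrightarrow> M $$ (i, j) = M $$ (j, i)"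
  shows "lam_min M * sqsum n x \<le> qform M x"
    and "\<exists>x. sqsum n x > 0 \<and> qform M x = lam_min M * sqsum n x"
proof -
  obtain k where k: "eigenvalue M k" "\<And>x. k * sqsum n x \<le> qform M x"
    by (rule qform_min_eigenvalue[OF M n sym]) auto
  have "lam_min M = k"
    unfolding lam_min_def
  proof (rule Min_eqI[OF finite_eigenvalues[OF M]])
    show "k \<in> {k. eigenvalue M k}" using k by simp
    fix l assume "l \<in> {k. eigenvalue M k}"
    then obtain x where "sqsum n x > 0" "qform M x = l * sqsum n x"
      using eigenvalue_imp_qform[OF M] by auto
    then show "k \<le> l" using k(2)[of x] by simp
  qed
  then show "lam_min M * sqsum n x \<le> qform M x"
    and "\<exists>x. sqsum n x > 0 \<and> qform M x = lam_min M * sqsum n x"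
    using k eigenvalue_imp_qform[OF M k(1)] by auto
qed

section \<open>Symmetric diagonal scaling\<close>

lemma scaled_carrier: "M \<in> carrier_mat n n \<Longrightarrow> scaled M \<in> carrier_mat n n"
  by (auto simp: scaled_def Let_def intro!: mult_carrier_mat)

lemma mult_mat_index_sum:
  assumes "A \<in> carrier_mat n n" "B \<in> carrier_mat n n" "i < n" "j < n"
  shows "(A * B) $$ (i, j) = (\<Sum>p<n. A $$ (i, p) * B $$ (p, j))"
  using assms by (simp add: scalar_prod_def lessThan_atLeast0)

lemma scaled_index:
  assumes M: "M \<in> carrier_mat n n" and i: "i < n" and j: "j < n"
  shows "scaled M $$ (i, j) = M $$ (i, j) / (sqrt (M $$ (i, i)) * sqrt (M $$ (j, j)))"
proof -
  define D where "D = mat n n (\<lambda>(i, j). if i = j then 1 / sqrt (M $$ (i, i)) else 0)"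
  have D: "D \<in> carrier_mat n n" by (simp add: D_def)
  have DM: "(D * M) $$ (i, l) = M $$ (i, l) / sqrt (M $$ (i, i))" if "l < n" for l
  proof -
    have "(D * M) $$ (i, l) = (\<Sum>p<n. D $$ (i, p) * M $$ (p, l))"
      by (rule mult_mat_index_sum[OF D M i that])
    also have "\<dots> = (\<Sum>p<n. if p = i then M $$ (i, l) / sqrt (M $$ (i, i)) else 0)"
      using i by (intro sum.cong) (auto simp: D_def)
    finally show ?thesis using i by simp
  qed
  have "(D * M * D) $$ (i, j) = (\<Sum>p<n. (D * M) $$ (i, p) * D $$ (p, j))"
    by (rule mult_mat_index_sum[OF mult_carrier_mat[OF D M] D i j])
  also have "\<dots> = (\<Sum>p<n. if p = j then (D * M) $$ (i, j) / sqrt (M $$ (j, j)) else 0)"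
    using j by (intro sum.cong) (auto simp: D_def)
  also have "\<dots> = (D * M) $$ (i, j) / sqrt (M $$ (j, j))" using j by simp
  finally have "(D * M * D) $$ (i, j) = M $$ (i, j) / (sqrt (M $$ (i, i)) * sqrt (M $$ (j, j)))"
    using DM[OF j] by simp
  then show ?thesis using M by (simp add: scaled_def Let_def D_def)
qed

text \<open>Scaling is a change of variables: eigenvalue estimates for \<open>scaled M\<close>
  become energy estimates for functions with coefficients x_i / sqrt(M_ii).\<close>

lemma qform_scaled:
  assumes M: "M \<in> carrier_mat n n"
  shows "qform (scaled M) x = qform M (\<lambda>i. x i / sqrt (M $$ (i, i)))"
  using M scaled_carrier[OF M]
  by (auto simp: qform_def scaled_index[OF M] intro!: sum.cong)

section \<open>Square-integrable functions on one element\<close>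

text \<open>Absolute integrability allows passage to the Lebesgue integral, where a nonnegative
  function with integral zero vanishes almost everywhere.\<close>

lemma negligible_nonzero_if_integral_zero:
  fixes f :: "real \<Rightarrow> real"
  assumes f: "f absolutely_integrable_on S" and nonneg: "\<And>x. x \<in> S \<Longrightarrow> 0 \<le> f x"
    and zero: "integral S f = 0"
  shows "negligible {x \<in> S. f x \<noteq> 0}"
proof -
  have int: "integrable lebesgue (\<lambda>x. indicat_real S x *\<^sub>R f x)"
    using f by (simp add: set_integrable_def)
  have "integral\<^sup>L lebesgue (\<lambda>x. indicat_real S x *\<^sub>R f x) = 0"
    using set_lebesgue_integral_eq_integral(2)[OF f] zero by (simp add: set_lebesgue_integral_def)
  then have "AE x in lebesgue. indicat_real S x *\<^sub>R f x = 0"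
    by (subst (asm) integral_nonneg_eq_0_iff_AE[OF int])
      (auto simp: indicator_def nonneg)
  then obtain K where K: "K \<in> null_sets lebesgue" "{x. indicat_real S x *\<^sub>R f x \<noteq> 0} \<subseteq> K"
    by (auto simp: eventually_ae_filter)
  have "{x \<in> S. f x \<noteq> 0} \<subseteq> K" using K(2) by auto
  then show ?thesis using K(1) negligible_iff_null_sets negligible_subset by blast
qed

text \<open>Lebesgue differentiation: off a null set, w x is the limit of its averages over
  {x..x+h}, and these averages are all zero.\<close>

lemma negligible_nonzero_if_integrals_zero:
  fixes w :: "real \<Rightarrow> real"
  assumes w: "w integrable_on {s..t}"
    and zero: "\<And>x y. s < x \<Longrightarrow> x \<le> y \<Longrightarrow> y < t \<Longrightarrow> integral {x..y} w = 0"
  shows "negligible {x \<in> {s<..<t}. w x \<noteq> 0}"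
proof -
  \<comment> \<open>The differentiation theorem asks for integrability on every box, hence the
    extension of \<open>w\<close> by zero.\<close>
  define g where "g x = (if x \<in> {s..t} then w x else 0)" for x
  have "g integrable_on cbox a b" for a b
  proof -
    have "g integrable_on UNIV"
      unfolding g_def using w by (simp only: integrable_restrict_UNIV)
    then show ?thesis by (rule integrable_on_subcbox) simp
  qed
  then obtain K where K: "negligible K"
    "\<And>x e. \<lbrakk>x \<notin> K; 0 < e\<rbrakk> \<Longrightarrow> \<exists>d>0. \<forall>h. 0 < h \<and> h < d \<longrightarrow>
        norm (integral (cbox x (x + h *\<^sub>R One)) g /\<^sub>R h ^ DIM(real) - g x) < e"
    by (rule integrable_ccontinuous_explicit) auto
  have "w x = 0" if x: "s < x" "x < t" "x \<notin> K" for x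
  proof (rule ccontr)
    assume "w x \<noteq> 0"
    then obtain d where d: "d > 0" "\<And>h. 0 < h \<and> h < d \<Longrightarrow>
        norm (integral (cbox x (x + h *\<^sub>R One)) g /\<^sub>R h ^ DIM(real) - g x) < \<bar>w x\<bar>"
      using K(2)[OF x(3), of "\<bar>w x\<bar>"] by auto
    \<comment> \<open>Halving both bounds keeps h below d and {x..x+h} inside the open interval,
      where the integrals are known to vanish.\<close>
    define h where "h = min (d / 2) ((t - x) / 2)"
    have h: "0 < h" "h < d" "x + h < t" using d(1) x by (auto simp: h_def min_def field_simps)
    have "integral {x..x + h} g = integral {x..x + h} w"
      using x h by (intro integral_cong) (auto simp: g_def)
    also have "\<dots> = 0" using x h by (intro zero) auto
    finally have "norm (- g x) < \<bar>w x\<bar>" using d(2)[of h] h by simp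
    then show False using x by (simp add: g_def)
  qed
  then have "{x \<in> {s<..<t}. w x \<noteq> 0} \<subseteq> K" by auto
  then show ?thesis using K(1) negligible_subset by blast
qed

text \<open>Requiring the endpoint values to vanish makes the products with a weight bounded
  only in the open interval integrable, and nonnegative for squares, without exceptional points.\<close>
definition edge_L2 :: "real \<Rightarrow> real \<Rightarrow> (real \<Rightarrow> real) \<Rightarrow> bool" where
  "edge_L2 s t f \<longleftrightarrow> f \<in> borel_measurable (lebesgue_on {s..t}) \<and>
     (\<lambda>x. (f x)\<^sup>2) integrable_on {s..t} \<and> f s = 0 \<and> f t = 0"

lemma edge_L2_zero: "edge_L2 s t (\<lambda>x. 0)"
  by (simp add: edge_L2_def integrable_0)

lemma edge_L2_scale:
  assumes "edge_L2 s t f"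
  shows "edge_L2 s t (\<lambda>x. c * f x)"
proof -
  have "(\<lambda>x. c\<^sup>2 * (f x)\<^sup>2) integrable_on {s..t}"
    using assms by (intro integrable_on_mult_right) (auto simp: edge_L2_def)
  then show ?thesis using assms by (auto simp: edge_L2_def power_mult_distrib)
qed

lemma square_sum_le: "((x::real) + y)\<^sup>2 \<le> 2 * x\<^sup>2 + 2 * y\<^sup>2"
  using zero_le_power2[of "x - y"] by (simp add: power2_eq_square algebra_simps)

lemma edge_L2_add:
  assumes f: "edge_L2 s t f" and g: "edge_L2 s t g"
  shows "edge_L2 s t (\<lambda>x. f x + g x)"
proof -
  have [measurable]: "f \<in> borel_measurable (lebesgue_on {s..t})" "g \<in> borel_measurable (lebesgue_on {s..t})"
    using f g by (auto simp: edge_L2_def)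
  have "(\<lambda>x. (f x + g x)\<^sup>2) integrable_on {s..t}"
  proof (rule measurable_bounded_by_integrable_imp_integrable)
    show "(\<lambda>x. 2 * (f x)\<^sup>2 + 2 * (g x)\<^sup>2) integrable_on {s..t}"
      using f g by (intro integrable_add integrable_on_mult_right) (auto simp: edge_L2_def)
  qed (auto intro: square_sum_le)
  then show ?thesis using f g by (auto simp: edge_L2_def)
qed

lemma edge_L2_sum:
  assumes "\<And>i. i \<in> I \<Longrightarrow> edge_L2 s t (f i)"
  shows "edge_L2 s t (\<lambda>x. \<Sum>i\<in>I. c i * f i x)"
proof (cases "finite I")
  case True
  then show ?thesis using assms
    by (induction I) (auto intro!: edge_L2_zero edge_L2_add edge_L2_scale)
qed (simp add: edge_L2_zero)

text \<open>Inside the interval the product is dominated by a multiple of f^2 + g^2. At the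
  endpoints, where \<open>a\<close> is not bounded, the product vanishes because \<open>f\<close>
  does.\<close>

lemma edge_L2_weighted_integrable:
  assumes a: "a \<in> borel_measurable (lebesgue_on {s..t})"
    and bnd: "\<And>x. s < x \<Longrightarrow> x < t \<Longrightarrow> 0 \<le> a x \<and> a x \<le> \<beta>"
    and f: "edge_L2 s t f" and g: "edge_L2 s t g"
  shows "(\<lambda>x. a x * f x * g x) absolutely_integrable_on {s..t}"
proof (rule measurable_bounded_by_integrable_imp_absolutely_integrable)
  have [measurable]: "f \<in> borel_measurable (lebesgue_on {s..t})" "g \<in> borel_measurable (lebesgue_on {s..t})"
    using f g by (auto simp: edge_L2_def)
  note a[measurable]
  show "(\<lambda>x. a x * f x * g x) \<in> borel_measurable (lebesgue_on {s..t})" by measurable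
  show "(\<lambda>x. \<bar>\<beta>\<bar> * ((f x)\<^sup>2 + (g x)\<^sup>2)) integrable_on {s..t}"
    using f g by (intro integrable_add integrable_on_mult_right) (auto simp: edge_L2_def)
  fix x assume x: "x \<in> {s..t}"
  show "norm (a x * f x * g x) \<le> \<bar>\<beta>\<bar> * ((f x)\<^sup>2 + (g x)\<^sup>2)"
  proof (cases "x = s \<or> x = t")
    case True
    then show ?thesis using f by (auto simp: edge_L2_def)
  next
    case False
    then have ax: "\<bar>a x\<bar> \<le> \<bar>\<beta>\<bar>" using bnd[of x] x by auto
    have "2 * (\<bar>f x\<bar> * \<bar>g x\<bar>) \<le> (f x)\<^sup>2 + (g x)\<^sup>2"
      using zero_le_power2[of "\<bar>f x\<bar> - \<bar>g x\<bar>"] by (simp add: power2_eq_square algebra_simps)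
    then have "\<bar>f x\<bar> * \<bar>g x\<bar> \<le> (f x)\<^sup>2 + (g x)\<^sup>2"
      using mult_nonneg_nonneg[OF abs_ge_zero abs_ge_zero, of "f x" "g x"] by linarith
    then have "\<bar>a x\<bar> * (\<bar>f x\<bar> * \<bar>g x\<bar>) \<le> \<bar>\<beta>\<bar> * ((f x)\<^sup>2 + (g x)\<^sup>2)"
      using ax by (intro mult_mono) auto
    then show ?thesis by (simp add: abs_mult mult.assoc)
  qed
qed simp

text \<open>Here \<open>f\<close> is the formal derivative of (c + m x) u with \<open>w\<close> in
  the role of u'. Both u and the affine factor are bounded, so square integrability of w passes to
  f.\<close>

lemma edge_L2_product_rule:
  fixes u w :: "real \<Rightarrow> real"
  assumes u: "continuous_on {s..t} u"
    and w: "w \<in> borel_measurable (lebesgue_on {s..t})" "(\<lambda>x. (w x)\<^sup>2) integrable_on {s..t}"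
    and f: "\<And>x. s < x \<Longrightarrow> x < t \<Longrightarrow> f x = m * u x + (c + m * x) * w x" "f s = 0" "f t = 0"
  shows "edge_L2 s t f"
proof -
  let ?L = "lebesgue_on {s..t}"
  have um [measurable]: "u \<in> borel_measurable ?L"
    using u by (intro continuous_imp_measurable_on_sets_lebesgue) auto
  note w(1)[measurable]
  have idm [measurable]: "(\<lambda>x. x) \<in> borel_measurable ?L"
    by (intro continuous_imp_measurable_on_sets_lebesgue continuous_intros) auto
  \<comment> \<open>The formula for \<open>f\<close> is assumed only in the open interval;
    measurability is transferred from this explicit function, which coincides with f on all of
    {s..t}.\<close>
  have "(\<lambda>x. if s < x \<and> x < t then m * u x + (c + m * x) * w x else 0) \<in> borel_measurable ?L"
    by measurable
  then have fm [measurable]: "f \<in> borel_measurable ?L"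
    by (rule measurable_cong[THEN iffD1, rotated]) (use f in force)
  \<comment> \<open>\<open>P\<close> bounds the affine factor on {s..t} whatever the signs of s and
    t.\<close>
  define P where "P = \<bar>c\<bar> + \<bar>m\<bar> * (\<bar>s\<bar> + \<bar>t\<bar>)"
  have "(\<lambda>x. (f x)\<^sup>2) integrable_on {s..t}"
  proof (rule measurable_bounded_by_integrable_imp_integrable)
    show "(\<lambda>x. 2 * m\<^sup>2 * (u x)\<^sup>2 + 2 * P\<^sup>2 * (w x)\<^sup>2) integrable_on {s..t}"
      by (rule integrable_add[OF integrable_continuous_real integrable_on_mult_right[OF w(2)]])
        (intro continuous_intros u)
    fix x assume x: "x \<in> {s..t}"
    show "norm ((f x)\<^sup>2) \<le> 2 * m\<^sup>2 * (u x)\<^sup>2 + 2 * P\<^sup>2 * (w x)\<^sup>2"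
    proof (cases "x = s \<or> x = t")
      case True
      then show ?thesis using f by auto
    next
      case False
      have "\<bar>m * x\<bar> \<le> \<bar>m\<bar> * (\<bar>s\<bar> + \<bar>t\<bar>)"
        using x unfolding abs_mult by (intro mult_left_mono) auto
      then have "\<bar>c + m * x\<bar> \<le> P" unfolding P_def by linarith
      then have "(c + m * x)\<^sup>2 \<le> P\<^sup>2" by (metis abs_ge_zero power2_abs power_mono)
      then have "(c + m * x)\<^sup>2 * (w x)\<^sup>2 \<le> P\<^sup>2 * (w x)\<^sup>2" by (rule mult_right_mono) simp
      then show ?thesis
        using square_sum_le[of "m * u x" "(c + m * x) * w x"] f(1)[of x] x False
        by (simp add: power_mult_distrib)
    qed
  qed auto
  then show ?thesis using fm f by (auto simp: edge_L2_def)
qed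

text \<open>If the formal derivative f = (p u)' of a product with affine p vanishes almost everywhere,
  then u' = w = - (m / p) u almost everywhere. The right-hand side is continuous, so u is
  classically differentiable and no product rule for absolutely continuous functions is needed.\<close>
lemma product_rule_zero_imp_zero:
  fixes u w :: "real \<Rightarrow> real"
  assumes st: "s < t"
    and u: "continuous_on {s..t} u" "u s = 0"
    and w: "\<And>x y. s < x \<Longrightarrow> x \<le> y \<Longrightarrow> y < t \<Longrightarrow> u y - u x = integral {x..y} w"
    and p: "\<And>x. s < x \<Longrightarrow> x < t \<Longrightarrow> c + m * x > 0"
    and null: "negligible {x \<in> {s<..<t}. m * u x + (c + m * x) * w x \<noteq> 0}"
    and x: "s < x" "x < t"
  shows "u x = 0"
proof -
  define g where "g x = - m * u x / (c + m * x)" for x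
  have ug: "u z - u y = integral {y..z} g" if "s < y" "y \<le> z" "z < t" for y z
  proof -
    have "integral {y..z} w = integral {y..z} g"
    proof (rule integral_spike[OF null])
      fix x assume x: "x \<in> {y..z} - {x \<in> {s<..<t}. m * u x + (c + m * x) * w x \<noteq> 0}"
      then have "s < x" "x < t" "m * u x + (c + m * x) * w x = 0" using that by auto
      then have "(c + m * x) * w x = - m * u x" "c + m * x \<noteq> 0" using p[of x] by auto
      then show "g x = w x" unfolding g_def by (simp add: field_simps)
    qed
    then show ?thesis using w that by simp
  qed
  have D: "((\<lambda>x. (c + m * x) * u x) has_real_derivative 0) (at x)" if x: "s < x" "x < t" for x
  proof -
    \<comment> \<open>The affine factor may vanish at an endpoint, as a hat function does at one end
      of its element. On the smaller closed interval {y..z} it is positive, so \<open>g\<close> is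
      continuous there.\<close>
    define y z where "y = (s + x) / 2" and "z = (x + t) / 2"
    have yz: "s < y" "y < x" "x < z" "z < t" using x by (auto simp: y_def z_def)
    have "continuous_on {y..z} u" using u(1) by (rule continuous_on_subset) (use yz in auto)
    moreover have "\<forall>r\<in>{y..z}. c + m * r \<noteq> 0"
    proof
      fix r assume "r \<in> {y..z}"
      then have "c + m * r > 0" using yz by (intro p) auto
      then show "c + m * r \<noteq> 0" by simp
    qed
    ultimately have "continuous_on {y..z} g" unfolding g_def
      by (intro continuous_intros)
    then have "((\<lambda>x. integral {y..x} g) has_real_derivative g x) (at x within {y..z})"
      by (rule integral_has_real_derivative) (use yz in auto)
    then have "((\<lambda>x. u y + integral {y..x} g) has_real_derivative g x) (at x within {y..z})"
      by (auto intro!: derivative_eq_intros)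
    moreover have "u y + integral {y..r} g = u r" if "r \<in> {y..z}" for r
      using ug[of y r] that yz by simp
    ultimately have "(u has_real_derivative g x) (at x within {y..z})"
      using has_field_derivative_transform_within[of _ _ x "{y..z}" 1 u] yz by simp
    then have "(u has_real_derivative g x) (at x)"
      using yz by (simp add: at_within_Icc_at)
    then have "((\<lambda>x. (c + m * x) * u x) has_real_derivative m * u x + (c + m * x) * g x) (at x)"
      by (auto intro!: derivative_eq_intros)
    moreover have "m * u x + (c + m * x) * g x = 0"
      unfolding g_def using p[OF x] by simp
    ultimately show ?thesis by simp
  qed
  \<comment> \<open>Continuity carries the constancy of the product to the left endpoint, where u
    vanishes; dividing by the positive factor at x then gives the claim.\<close>
  have "(c + m * x) * u x = (c + m * s) * u s"
  proof (rule DERIV_isconst2[OF st])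
    show "continuous_on {s..t} (\<lambda>x. (c + m * x) * u x)"
      by (intro continuous_intros u)
  qed (use D x in auto)
  then show ?thesis using u(2) p[OF x] by simp
qed

section \<open>Energies on the mesh\<close>

locale enriched_mesh =
  fixes N :: nat and a :: "real \<Rightarrow> real" and \<alpha> \<beta> :: real
    and \<phi> d\<phi> :: "nat \<Rightarrow> real \<Rightarrow> real"
  assumes N: "N \<ge> 1"
    and a_meas: "a measurable_on {0..1}"
    and a_bnd: "0 < \<alpha>" "\<forall>x. 0 < x \<and> x < 1 \<longrightarrow> \<alpha> \<le> a x \<and> a x \<le> \<beta>"
    and phi_H1: "\<forall>i\<le>N. H1_patch N \<phi> d\<phi> i"
begin

lemma Npos: "real N > 0" using N by simp

lemma node_less_iff [simp]: "node N i < node N j \<longleftrightarrow> i < j"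
  using Npos by (simp add: node_def field_simps)

lemma node_le_iff [simp]: "node N i \<le> node N j \<longleftrightarrow> i \<le> j"
  using Npos by (simp add: node_def field_simps)

lemma node_0 [simp]: "node N 0 = 0" and node_N [simp]: "node N N = 1"
  using N by (simp_all add: node_def)

lemma node_subset: "k \<in> {1..N} \<Longrightarrow> 0 \<le> node N (k - 1) \<and> node N k \<le> 1"
  using node_le_iff[of 0 "k - 1"] node_le_iff[of k N] by simp

text \<open>Formulated element by element because derivatives of the basis functions jump at the
  nodes; \<open>dhat\<close> and \<open>denr\<close> take the value 0 there, as
  \<open>edge_L2\<close> demands.\<close>

definition mesh_L2 :: "(real \<Rightarrow> real) \<Rightarrow> bool" where
  "mesh_L2 f \<longleftrightarrow> (\<forall>k\<in>{1..N}. edge_L2 (node N (k - 1)) (node N k) f)"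

lemma mesh_L2_add: "mesh_L2 f \<Longrightarrow> mesh_L2 g \<Longrightarrow> mesh_L2 (\<lambda>x. f x + g x)"
  by (simp add: mesh_L2_def edge_L2_add)

lemma mesh_L2_sum: "(\<And>i. i \<in> I \<Longrightarrow> mesh_L2 (f i)) \<Longrightarrow> mesh_L2 (\<lambda>x. \<Sum>i\<in>I. c i * f i x)"
  unfolding mesh_L2_def by (intro ballI edge_L2_sum) auto

lemma a_element:
  assumes k: "k \<in> {1..N}"
  shows "a \<in> borel_measurable (lebesgue_on {node N (k - 1)..node N k})"
    and "node N (k - 1) < x \<Longrightarrow> x < node N k \<Longrightarrow> \<alpha> \<le> a x \<and> a x \<le> \<beta>"
proof -
  have "a \<in> borel_measurable (lebesgue_on {0..1})"
    using a_meas by (subst (asm) measurable_on_iff_borel_measurable) auto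
  then show "a \<in> borel_measurable (lebesgue_on {node N (k - 1)..node N k})"
    by (rule measurable_restrict_mono) (use node_subset[OF k] in auto)
  show "node N (k - 1) < x \<Longrightarrow> x < node N k \<Longrightarrow> \<alpha> \<le> a x \<and> a x \<le> \<beta>"
    using node_subset[OF k] by (intro a_bnd(2)[rule_format]) linarith
qed

lemma BT_absolutely_integrable:
  assumes k: "k \<in> {1..N}" and f: "mesh_L2 f" and g: "mesh_L2 g"
  shows "(\<lambda>x. a x * f x * g x) absolutely_integrable_on {node N (k - 1)..node N k}"
proof (rule edge_L2_weighted_integrable)
  show "\<And>x. node N (k - 1) < x \<Longrightarrow> x < node N k \<Longrightarrow> 0 \<le> a x \<and> a x \<le> \<beta>"
    using a_element(2)[OF k] a_bnd(1) by fastforce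
qed (use a_element(1)[OF k] f g k in \<open>auto simp: mesh_L2_def\<close>)

lemma BT_integrable:
  assumes "k \<in> {1..N}" and "mesh_L2 f" and "mesh_L2 g"
  shows "(\<lambda>x. a x * f x * g x) integrable_on {node N (k - 1)..node N k}"
  using BT_absolutely_integrable[OF assms] by (simp add: absolutely_integrable_on_def)

text \<open>At the end nodes \<open>f\<close> is zero, which covers the points 0 and 1, where the
  sign of \<open>a\<close> is unknown.\<close>

lemma weighted_square_nonneg:
  assumes k: "k \<in> {1..N}" and f: "mesh_L2 f" and x: "x \<in> {node N (k - 1)..node N k}"
  shows "0 \<le> a x * f x * f x"
proof (cases "x = node N (k - 1) \<or> x = node N k")
  case True
  then show ?thesis using f k by (auto simp: mesh_L2_def edge_L2_def)
next
  case False
  then have "0 \<le> a x" using x a_element(2)[OF k, of x] a_bnd(1) by auto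
  then show ?thesis by (simp add: mult.assoc)
qed

lemma BT_nonneg: "k \<in> {1..N} \<Longrightarrow> mesh_L2 f \<Longrightarrow> 0 \<le> BT N a k f f"
  unfolding BT_def using weighted_square_nonneg by (intro integral_nonneg BT_integrable) auto

lemma BT_commute: "BT N a k f g = BT N a k g f"
  by (simp add: BT_def mult_ac)

lemma BT_sum_left:
  assumes k: "k \<in> {1..N}" and f: "\<And>i. i \<in> I \<Longrightarrow> mesh_L2 (f i)" and g: "mesh_L2 g"
    and I: "finite I"
  shows "BT N a k (\<lambda>x. \<Sum>i\<in>I. c i * f i x) g = (\<Sum>i\<in>I. c i * BT N a k (f i) g)"
proof -
  let ?S = "{node N (k - 1)..node N k}"
  have "BT N a k (\<lambda>x. \<Sum>i\<in>I. c i * f i x) g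
      = integral ?S (\<lambda>x. \<Sum>i\<in>I. c i * (a x * f i x * g x))"
    by (simp add: BT_def sum_distrib_left sum_distrib_right mult_ac)
  also have "\<dots> = (\<Sum>i\<in>I. integral ?S (\<lambda>x. c i * (a x * f i x * g x)))"
    using BT_integrable[OF k f g] by (intro integral_sum I integrable_on_mult_right) auto
  finally show ?thesis by (simp add: BT_def)
qed

lemma BT_sum_sum:
  assumes k: "k \<in> {1..N}" and f: "\<And>i. i \<in> I \<Longrightarrow> mesh_L2 (f i)" and I: "finite I"
  shows "BT N a k (\<lambda>x. \<Sum>i\<in>I. c i * f i x) (\<lambda>x. \<Sum>i\<in>I. c i * f i x)
    = (\<Sum>i\<in>I. \<Sum>j\<in>I. c i * BT N a k (f i) (f j) * c j)"
proof -
  let ?F = "\<lambda>x. \<Sum>i\<in>I. c i * f i x"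
  have F: "mesh_L2 ?F" using f by (rule mesh_L2_sum)
  have "BT N a k (f i) ?F = (\<Sum>j\<in>I. c j * BT N a k (f i) (f j))" if "i \<in> I" for i
    using BT_sum_left[OF k f f[OF that] I] by (simp add: BT_commute[of k "f i"])
  then show ?thesis
    using BT_sum_left[OF k f F I] by (simp add: sum_distrib_left mult_ac)
qed

text \<open>The induction over initial segments {0..x_n} carries integrability along with the value,
  since integrals over adjacent intervals combine only for an integrable function.\<close>

lemma Bf_eq_sum_BT:
  assumes f: "mesh_L2 f" and g: "mesh_L2 g"
  shows "Bf a f g = (\<Sum>k=1..N. BT N a k f g)"
proof -
  let ?h = "\<lambda>x. a x * f x * g x"
  have "?h integrable_on {0..node N n} \<and> integral {0..node N n} ?h = (\<Sum>k=1..n. BT N a k f g)"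
    if "n \<le> N" for n
    using that
  proof (induction n)
    case 0
    then show ?case using integrable_on_refl[of ?h 0] integral_refl[of 0 ?h] by simp
  next
    case (Suc n)
    then have IH: "?h integrable_on {0..node N n}"
      "integral {0..node N n} ?h = (\<Sum>k=1..n. BT N a k f g)" by auto
    have el: "?h integrable_on {node N n..node N (Suc n)}"
      using BT_integrable[OF _ f g, of "Suc n"] Suc.prems by simp
    have le: "0 \<le> node N n" "node N n \<le> node N (Suc n)"
      using node_le_iff[of 0 n] by auto
    have int: "?h integrable_on {0..node N (Suc n)}"
      by (rule Henstock_Kurzweil_Integration.integrable_combine[OF le IH(1) el])
    have "integral {0..node N (Suc n)} ?h
        = integral {0..node N n} ?h + integral {node N n..node N (Suc n)} ?h"
      using Henstock_Kurzweil_Integration.integral_combine[OF le int] by simp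
    then show ?case using int IH(2) by (simp add: BT_def)
  qed
  from this[of N] show ?thesis by (simp add: Bf_def)
qed

lemma Bf_nonneg: "mesh_L2 f \<Longrightarrow> 0 \<le> Bf a f f"
  unfolding Bf_eq_sum_BT by (intro sum_nonneg BT_nonneg)

lemma Bf_commute: "Bf a f g = Bf a g f"
  by (simp add: Bf_def mult_ac)

lemma Bf_sum_sum:
  assumes f: "\<And>i. i \<in> I \<Longrightarrow> mesh_L2 (f i)" and I: "finite I"
  shows "Bf a (\<lambda>x. \<Sum>i\<in>I. c i * f i x) (\<lambda>x. \<Sum>i\<in>I. c i * f i x)
    = (\<Sum>i\<in>I. \<Sum>j\<in>I. c i * Bf a (f i) (f j) * c j)"
proof -
  have "Bf a (\<lambda>x. \<Sum>i\<in>I. c i * f i x) (\<lambda>x. \<Sum>i\<in>I. c i * f i x)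
    = (\<Sum>k=1..N. \<Sum>i\<in>I. \<Sum>j\<in>I. c i * BT N a k (f i) (f j) * c j)"
    using f by (simp add: Bf_eq_sum_BT mesh_L2_sum BT_sum_sum[OF _ f I])
  also have "\<dots> = (\<Sum>i\<in>I. \<Sum>k=1..N. \<Sum>j\<in>I. c i * BT N a k (f i) (f j) * c j)"
    by (rule sum.swap)
  also have "\<dots> = (\<Sum>i\<in>I. \<Sum>j\<in>I. \<Sum>k=1..N. c i * BT N a k (f i) (f j) * c j)"
    by (intro sum.cong sum.swap refl)
  also have "\<dots> = (\<Sum>i\<in>I. \<Sum>j\<in>I. c i * Bf a (f i) (f j) * c j)"
    using f by (intro sum.cong refl) (simp add: Bf_eq_sum_BT sum_distrib_left sum_distrib_right)
  finally show ?thesis .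
qed

lemma BT_null:
  assumes k: "k \<in> {1..N}" and "negligible {x \<in> {node N (k - 1)..node N k}. f x \<noteq> 0}"
  shows "BT N a k f g = 0" "BT N a k g f = 0"
proof -
  have "BT N a k f g = integral {node N (k - 1)..node N k} (\<lambda>x. 0)"
    unfolding BT_def by (rule integral_spike[OF assms(2)]) auto
  then show "BT N a k f g = 0" "BT N a k g f = 0" by (simp_all add: BT_commute[of k g])
qed

text \<open>Definiteness of the local energy: a f^2 vanishes almost everywhere, and \<open>a\<close>
  is at least \<alpha> > 0 inside the element.\<close>

lemma BT_eq_0_imp_negligible:
  assumes k: "k \<in> {1..N}" and f: "mesh_L2 f" and zero: "BT N a k f f = 0"
  shows "negligible {x \<in> {node N (k - 1)..node N k}. f x \<noteq> 0}"
proof -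
  have "negligible {x \<in> {node N (k - 1)..node N k}. a x * f x * f x \<noteq> 0}"
    using zero weighted_square_nonneg[OF k f]
    by (intro negligible_nonzero_if_integral_zero BT_absolutely_integrable k f) (auto simp: BT_def)
  moreover have "{x \<in> {node N (k - 1)..node N k}. f x \<noteq> 0}
      \<subseteq> {x \<in> {node N (k - 1)..node N k}. a x * f x * f x \<noteq> 0}"
  proof
    fix x assume x: "x \<in> {x \<in> {node N (k - 1)..node N k}. f x \<noteq> 0}"
    then have "x \<noteq> node N (k - 1)" "x \<noteq> node N k"
      using f k by (auto simp: mesh_L2_def edge_L2_def)
    then have "a x \<noteq> 0" using x a_element(2)[OF k, of x] a_bnd(1) by auto
    then show "x \<in> {x \<in> {node N (k - 1)..node N k}. a x * f x * f x \<noteq> 0}" using x by simp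
  qed
  ultimately show ?thesis by (rule negligible_subset)
qed

section \<open>Hat functions and enrichment functions restricted to one element\<close>

lemma dhat_node [simp]: "dhat N i (node N j) = 0"
  by (auto simp: dhat_def)

text \<open>Turns the position tests in the piecewise definitions into index comparisons. The left
  neighbour is written i + 1 = k to avoid truncated subtraction.\<close>

lemma in_element_iff:
  assumes "1 \<le> k" "node N (k - 1) < x" "x < node N k"
  shows "1 \<le> i \<and> node N (i - 1) < x \<and> x < node N i \<longleftrightarrow> i = k"
    and "node N i < x \<and> x < node N (i + 1) \<longleftrightarrow> i + 1 = k"
proof -
  have *: "i = k" if "1 \<le> i" "node N (i - 1) < x" "x < node N i" for i
  proof -
    have "node N (i - 1) < node N k" "node N (k - 1) < node N i" using assms that by linarith+
    then show ?thesis using assms(1) that(1) by simp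
  qed
  show "1 \<le> i \<and> node N (i - 1) < x \<and> x < node N i \<longleftrightarrow> i = k"
    using *[of i] assms by blast
  show "node N i < x \<and> x < node N (i + 1) \<longleftrightarrow> i + 1 = k"
  proof
    assume "node N i < x \<and> x < node N (i + 1)"
    then show "i + 1 = k" using *[of "i + 1"] by simp
  next
    assume ik: "i + 1 = k"
    then have "k - 1 = i" by simp
    then show "node N i < x \<and> x < node N (i + 1)" using assms(2,3) ik by simp
  qed
qed

lemma dhat_element:
  assumes "k \<in> {1..N}" "node N (k - 1) < x" "x < node N k"
  shows "dhat N i x = (if i = k then real N else if i + 1 = k then - real N else 0)"
  using assms in_element_iff[of k x i] unfolding dhat_def by auto

lemma dphibar_node [simp]: "dphibar N \<phi> d\<phi> i (node N j) = 0"
  by (auto simp: dphibar_def)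

lemma denr_node [simp]: "denr N \<phi> d\<phi> i (node N j) = 0"
  by (simp add: denr_def)

lemma dphibar_element:
  assumes "k \<in> {1..N}" "node N (k - 1) < x" "x < node N k"
  shows "dphibar N \<phi> d\<phi> i x = (if i = k \<or> i + 1 = k
    then d\<phi> i x - real N * (\<phi> i (node N k) - \<phi> i (node N (k - 1))) else 0)"
  using assms in_element_iff[of k x i] unfolding dphibar_def by auto

text \<open>N x - (k - 1) and k - N x are the local coordinates of the element. They are kept in the
  shape c + m x that the product-rule lemmas expect.\<close>

lemma hatf_element:
  assumes "k \<in> {1..N}" "node N (k - 1) < x" "x < node N k"
  shows "i = k \<Longrightarrow> hatf N i x = (1 - real k) + real N * x"
    and "i + 1 = k \<Longrightarrow> hatf N i x = real k + (- real N) * x"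
    and "i = k \<Longrightarrow> (1 - real k) + real N * x > 0"
    and "i + 1 = k \<Longrightarrow> real k + (- real N) * x > 0"
proof -
  have b: "real k - 1 < real N * x" "real N * x < real k"
    using assms Npos by (auto simp: node_def field_simps of_nat_diff)
  show "i = k \<Longrightarrow> (1 - real k) + real N * x > 0"
    and "i + 1 = k \<Longrightarrow> real k + (- real N) * x > 0" using b by auto
  have nx: "real N * node N j = real j" for j using Npos by (simp add: node_def)
  show "hatf N i x = (1 - real k) + real N * x" if "i = k"
    using assms b nx[of k] that by (simp add: hatf_def algebra_simps)
  show "hatf N i x = real k + (- real N) * x" if "i + 1 = k"
    using assms b nx[of i] that by (auto simp add: hatf_def algebra_simps)
qed

lemma phibar_element:
  assumes k: "k \<in> {1..N}" and x: "node N (k - 1) < x" "x < node N k"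
  shows "phibar N \<phi> i x = (if i = k \<or> i + 1 = k
    then \<phi> i x - (\<phi> i (node N (k - 1))
      + (\<phi> i (node N k) - \<phi> i (node N (k - 1))) * real N * (x - node N (k - 1))) else 0)"
proof -
  consider "i = k" | "i + 1 = k" | "i + 1 < k" | "k < i" by linarith
  then show ?thesis
  proof cases
    case 1
    have "node N k \<le> hi N k" using k by (simp add: hi_def)
    then show ?thesis using 1 x k by (auto simp: phibar_def interp_def lo_def)
  next
    case 2
    have "node N k \<le> hi N i" "lo N i \<le> node N (k - 1)" using k 2 by (auto simp: hi_def lo_def)
    moreover have "k - 1 = i" using 2 by simp
    ultimately show ?thesis using 2 x k by (auto simp: phibar_def interp_def)
  next
    case 3
    then have "hi N i \<le> node N (k - 1)" using k by (auto simp: hi_def)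
    then show ?thesis using 3 x by (auto simp: phibar_def)
  next
    case 4
    then have "node N k \<le> lo N i" by (auto simp: lo_def)
    then show ?thesis using 4 x by (auto simp: phibar_def)
  qed
qed

lemma hatf_element_outside:
  assumes k: "k \<in> {1..N}" and x: "node N (k - 1) < x" "x < node N k" and i: "i \<noteq> k" "i + 1 \<noteq> k"
  shows "hatf N i x = 0"
proof -
  have b: "real k - 1 < real N * x" "real N * x < real k"
    using k x Npos by (auto simp: node_def field_simps of_nat_diff)
  have "real N * \<bar>x - node N i\<bar> = \<bar>real N * x - real i\<bar>"
    using Npos by (simp add: node_def abs_if field_simps)
  moreover have "i + 2 \<le> k \<or> k + 1 \<le> i" using i by linarith
  then have "\<bar>real N * x - real i\<bar> \<ge> 1"
  proof
    assume "i + 2 \<le> k"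
    then have "real i + 2 \<le> real k" by linarith
    then show ?thesis using b by linarith
  next
    assume "k + 1 \<le> i"
    then have "real k + 1 \<le> real i" by linarith
    then show ?thesis using b by linarith
  qed
  ultimately show ?thesis by (simp add: hatf_def)
qed

lemma denr_outside:
  assumes k: "k \<in> {1..N}" and x: "x \<in> {node N (k - 1)..node N k}" and i: "i \<noteq> k" "i + 1 \<noteq> k"
  shows "denr N \<phi> d\<phi> i x = 0"
proof (cases "x = node N (k - 1) \<or> x = node N k")
  case True
  then show ?thesis by auto
next
  case False
  then have "node N (k - 1) < x" "x < node N k" using x by auto
  then show ?thesis
    using dhat_element[OF k, of x i] hatf_element_outside[OF k _ _ i, of x] i by (simp add: denr_def)
qed

text \<open>Supplies the data for both product-rule lemmas: u is \<open>phibar\<close> continued up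
  to the nodes, w its weak derivative, c + m x the hat function. u vanishes at the left node because
  the interpolant agrees with \<phi> there.\<close>

lemma denr_element:
  assumes k: "k \<in> {1..N}" and i: "i \<le> N" "i = k \<or> i + 1 = k"
  obtains u w c m where
    "continuous_on {node N (k - 1)..node N k} u" "u (node N (k - 1)) = 0"
    "w \<in> borel_measurable (lebesgue_on {node N (k - 1)..node N k})"
    "w integrable_on {node N (k - 1)..node N k}"
    "(\<lambda>x. (w x)\<^sup>2) integrable_on {node N (k - 1)..node N k}"
    "\<And>x y. node N (k - 1) < x \<Longrightarrow> x \<le> y \<Longrightarrow> y < node N k \<Longrightarrow> u y - u x = integral {x..y} w"
    "\<And>x. node N (k - 1) < x \<Longrightarrow> x < node N k \<Longrightarrow> c + m * x > 0"
    "\<And>x. node N (k - 1) < x \<Longrightarrow> x < node N k \<Longrightarrow> phibar N \<phi> i x = u x"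
    "\<And>x. node N (k - 1) < x \<Longrightarrow> x < node N k \<Longrightarrow> denr N \<phi> d\<phi> i x = m * u x + (c + m * x) * w x"
proof -
  define s t where "s = node N (k - 1)" and "t = node N k"
  \<comment> \<open>\<open>C\<close> is the slope of the interpolant on this element, whose length
    is 1/N.\<close>
  define C where "C = real N * (\<phi> i t - \<phi> i s)"
  define u where "u x = \<phi> i x - (\<phi> i s + C * (x - s))" for x
  define w where "w x = d\<phi> i x - C" for x
  define m where "m = (if i = k then real N else - real N)"
  define c where "c = (if i = k then 1 - real k else real k)"
  have H: "d\<phi> i absolutely_integrable_on {lo N i..hi N i}"
     "(\<lambda>x. (d\<phi> i x)\<^sup>2) integrable_on {lo N i..hi N i}"
     "\<And>x. x\<in>{lo N i..hi N i} \<Longrightarrow> \<phi> i x = \<phi> i (lo N i) + integral {lo N i..x} (d\<phi> i)"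
    using phi_H1 i(1) unfolding H1_patch_def by blast+
  have lohi: "lo N i \<le> s" "t \<le> hi N i"
    using i k by (auto simp: lo_def hi_def s_def t_def)
  then have sub: "{s..t} \<subseteq> {lo N i..hi N i}" by auto
  have Hint: "d\<phi> i integrable_on {lo N i..hi N i}"
    using H(1) by (simp add: absolutely_integrable_on_def)
  have dint: "d\<phi> i integrable_on {x..y}" if "s \<le> x" "y \<le> t" for x y
    using Hint by (rule integrable_on_subinterval) (use that lohi in auto)
  have dm [measurable]: "d\<phi> i \<in> borel_measurable (lebesgue_on {s..t})"
    using dint[of s t] by (intro integrable_imp_measurable) auto
  have d2: "(\<lambda>x. (d\<phi> i x)\<^sup>2) integrable_on {s..t}"
    using H(2) by (rule integrable_on_subinterval) (use sub in auto)
  \<comment> \<open>\<open>H1_patch\<close> anchors the integral representation at the left end of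
    the patch; subtracting two instances moves the anchor into the element.\<close>
  have FTC: "\<phi> i y - \<phi> i x = integral {x..y} (d\<phi> i)" if "s \<le> x" "x \<le> y" "y \<le> t" for x y
  proof -
    have "integral {lo N i..x} (d\<phi> i) + integral {x..y} (d\<phi> i) = integral {lo N i..y} (d\<phi> i)"
      using that lohi
      by (intro Henstock_Kurzweil_Integration.integral_combine integrable_on_subinterval[OF Hint]) auto
    moreover have "\<phi> i x = \<phi> i (lo N i) + integral {lo N i..x} (d\<phi> i)"
      by (rule H(3)) (use that lohi in auto)
    moreover have "\<phi> i y = \<phi> i (lo N i) + integral {lo N i..y} (d\<phi> i)"
      by (rule H(3)) (use that lohi in auto)
    ultimately show ?thesis by linarith
  qed
  have "continuous_on {s..t} (\<lambda>x. \<phi> i s + integral {s..x} (d\<phi> i))"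
    by (intro continuous_intros indefinite_integral_continuous_1 dint) auto
  moreover have "\<phi> i s + integral {s..x} (d\<phi> i) = \<phi> i x" if "x \<in> {s..t}" for x
    using FTC[of s x] that by simp
  ultimately have "continuous_on {s..t} (\<phi> i)"
    by (rule continuous_on_eq)
  then have 1: "continuous_on {s..t} u"
    unfolding u_def by (intro continuous_intros)
  have 2: "u s = 0" by (simp add: u_def)
  have 3 [measurable]: "w \<in> borel_measurable (lebesgue_on {s..t})" unfolding w_def by measurable
  have 4: "w integrable_on {s..t}" unfolding w_def using dint[of s t] by (intro integrable_diff) auto
  have 5: "(\<lambda>x. (w x)\<^sup>2) integrable_on {s..t}"
  proof (rule measurable_bounded_by_integrable_imp_integrable)
    show "(\<lambda>x. 2 * (d\<phi> i x)\<^sup>2 + 2 * C\<^sup>2) integrable_on {s..t}"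
      using d2 by (intro integrable_add integrable_on_mult_right) auto
    show "norm ((w x)\<^sup>2) \<le> 2 * (d\<phi> i x)\<^sup>2 + 2 * C\<^sup>2" for x
      using square_sum_le[of "d\<phi> i x" "- C"] by (simp add: w_def)
  qed auto
  have 6: "u y - u x = integral {x..y} w" if "s < x" "x \<le> y" "y < t" for x y
  proof -
    have "integral {x..y} w = integral {x..y} (d\<phi> i) - integral {x..y} (\<lambda>_. C)"
      unfolding w_def using that by (intro integral_diff dint) auto
    also have "\<dots> = \<phi> i y - \<phi> i x - C * (y - x)" using FTC[of x y] that by simp
    finally show ?thesis by (simp add: u_def algebra_simps)
  qed
  have 7: "c + m * x > 0" if "s < x" "x < t" for x
    using hatf_element(3,4)[OF k, of x i] that i unfolding s_def t_def c_def m_def by auto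
  have 8: "phibar N \<phi> i x = u x" if "s < x" "x < t" for x
    using phibar_element[OF k, of x i] that i unfolding s_def t_def u_def C_def by (auto simp: mult_ac)
  have 9: "denr N \<phi> d\<phi> i x = m * u x + (c + m * x) * w x" if "s < x" "x < t" for x
  proof -
    have "hatf N i x = c + m * x"
      using hatf_element(1,2)[OF k, of x i] that i unfolding s_def t_def c_def m_def by auto
    moreover have "dhat N i x = m"
      using dhat_element[OF k, of x i] that i unfolding s_def t_def m_def by auto
    moreover have "dphibar N \<phi> d\<phi> i x = w x"
      using dphibar_element[OF k, of x i] that i unfolding s_def t_def w_def C_def by auto
    ultimately show ?thesis using 8[OF that] by (simp add: denr_def)
  qed
  show ?thesis
    using that[OF 1[unfolded s_def t_def] 2[unfolded s_def] 3[unfolded s_def t_def]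
        4[unfolded s_def t_def] 5[unfolded s_def t_def] 6[unfolded s_def t_def]
        7[unfolded s_def t_def] 8[unfolded s_def t_def] 9[unfolded s_def t_def]] by blast
qed

lemma mesh_L2_dhat: "mesh_L2 (dhat N i)"
  unfolding mesh_L2_def
proof
  fix k assume k: "k \<in> {1..N}"
  define m where "m = (if i = k then real N else if i + 1 = k then - real N else 0)"
  show "edge_L2 (node N (k - 1)) (node N k) (dhat N i)"
    \<comment> \<open>With u = 1 and w = 0 only the constant slope \<open>m\<close> survives in the
      product rule.\<close>
    by (rule edge_L2_product_rule[of _ _ "\<lambda>x. 1" "\<lambda>x. 0" _ m])
      (use dhat_element[OF k] in \<open>auto simp: m_def integrable_0\<close>)
qed

lemma mesh_L2_denr:
  assumes i: "i \<le> N"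
  shows "mesh_L2 (denr N \<phi> d\<phi> i)"
  unfolding mesh_L2_def
proof
  fix k assume k: "k \<in> {1..N}"
  show "edge_L2 (node N (k - 1)) (node N k) (denr N \<phi> d\<phi> i)"
  proof (cases "i = k \<or> i + 1 = k")
    case True
    then show ?thesis
      by (rule denr_element[OF k i], intro edge_L2_product_rule) auto
  next
    case False
    then show ?thesis
      using denr_outside[OF k, of _ i]
      by (intro edge_L2_product_rule[of _ _ "\<lambda>x. 0" "\<lambda>x. 0" _ 0]) (auto simp: integrable_0)
  qed
qed

text \<open>Forward, the product-rule lemma applies because the hat function is positive inside the
  element. Backward, a vanishing \<open>phibar\<close> makes all integrals of its weak derivative
  zero, which gives w = 0 only almost everywhere; hence the null set on the left.\<close>

lemma denr_null_iff:
  assumes k: "k \<in> {1..N}" and i: "i \<le> N"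
  shows "negligible {x \<in> {node N (k - 1)..node N k}. denr N \<phi> d\<phi> i x \<noteq> 0}
     \<longleftrightarrow> (\<forall>x. node N (k - 1) < x \<and> x < node N k \<longrightarrow> phibar N \<phi> i x = 0)"
    (is "negligible ?Z \<longleftrightarrow> ?zero")
proof (cases "i = k \<or> i + 1 = k")
  case False
  then have "?Z = {}" using denr_outside[OF k, of _ i] by auto
  moreover have ?zero using phibar_element[OF k, of _ i] False by auto
  ultimately show ?thesis by (auto simp only: negligible_empty)
next
  case True
  define s t where "s = node N (k - 1)" and "t = node N k"
  have st: "s < t" using k by (simp add: s_def t_def)
  obtain u w c m where uw:
    "continuous_on {s..t} u" "u s = 0"
    "w integrable_on {s..t}"
    "\<And>x y. s < x \<Longrightarrow> x \<le> y \<Longrightarrow> y < t \<Longrightarrow> u y - u x = integral {x..y} w"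
    "\<And>x. s < x \<Longrightarrow> x < t \<Longrightarrow> c + m * x > 0"
    "\<And>x. s < x \<Longrightarrow> x < t \<Longrightarrow> phibar N \<phi> i x = u x"
    "\<And>x. s < x \<Longrightarrow> x < t \<Longrightarrow> denr N \<phi> d\<phi> i x = m * u x + (c + m * x) * w x"
    unfolding s_def t_def by (rule denr_element[OF k i True]) blast
  show ?thesis
    unfolding s_def[symmetric] t_def[symmetric]
  proof
    assume "negligible {x \<in> {s..t}. denr N \<phi> d\<phi> i x \<noteq> 0}"
    then have "negligible {x \<in> {s<..<t}. m * u x + (c + m * x) * w x \<noteq> 0}"
      by (rule negligible_subset) (use uw(7) in auto)
    then show "\<forall>x. s < x \<and> x < t \<longrightarrow> phibar N \<phi> i x = 0"
      using product_rule_zero_imp_zero[OF st uw(1,2,4,5)] uw(6) by auto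
  next
    assume z: "\<forall>x. s < x \<and> x < t \<longrightarrow> phibar N \<phi> i x = 0"
    have "negligible {x \<in> {s<..<t}. w x \<noteq> 0}"
      by (rule negligible_nonzero_if_integrals_zero[OF uw(3)])
        (use uw(4) uw(6) z in \<open>metis (no_types, lifting) diff_self le_less_trans less_le_trans\<close>)
    then show "negligible {x \<in> {s..t}. denr N \<phi> d\<phi> i x \<noteq> 0}"
    proof (rule negligible_subset, intro subsetI)
      fix x assume x: "x \<in> {x \<in> {s..t}. denr N \<phi> d\<phi> i x \<noteq> 0}"
      then have "x \<noteq> s" "x \<noteq> t" by (auto simp: s_def t_def)
      then have "s < x" "x < t" using x by auto
      then show "x \<in> {x \<in> {s<..<t}. w x \<noteq> 0}" using x uw(6,7)[of x] z by auto
    qed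
  qed
qed

end

lemma sum_lessThan_add:
  fixes f :: "nat \<Rightarrow> 'a::comm_monoid_add"
  shows "(\<Sum>p<n + m. f p) = (\<Sum>p<n. f p) + (\<Sum>q<m. f (n + q))"
  by (induction m) (simp_all add: add.assoc)

section \<open>Associated vertices, element matrices and assembly of \<open>Delta\<close>;
  positivity of the hat block\<close>

context enriched_mesh
begin

lemma T2_le: "j \<in> T2 N \<phi> \<Longrightarrow> j \<le> N"
  by (simp add: T2_def)

lemma finite_T2: "finite (T2 N \<phi>)"
  by (rule finite_subset[of _ "{..N}"]) (auto simp: T2_def)

lemma nz_imp_adjacent:
  assumes "k \<in> {1..N}" "nz N \<phi> k j"
  shows "j = k \<or> j + 1 = k"
  using assms phibar_element[of k _ j] by (auto simp: nz_def split: if_splits)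

lemma BT_not_nz:
  assumes k: "k \<in> {1..N}" and j: "j \<in> T2 N \<phi>" "\<not> nz N \<phi> k j"
  shows "BT N a k (denr N \<phi> d\<phi> j) g = 0" "BT N a k g (denr N \<phi> d\<phi> j) = 0"
proof -
  have "negligible {x \<in> {node N (k - 1)..node N k}. denr N \<phi> d\<phi> j x \<noteq> 0}"
    using denr_null_iff[OF k T2_le[OF j(1)]] j unfolding nz_def by blast
  then show "BT N a k (denr N \<phi> d\<phi> j) g = 0" "BT N a k g (denr N \<phi> d\<phi> j) = 0"
    using BT_null[OF k] by blast+
qed

lemma BT_nz_pos:
  assumes k: "k \<in> {1..N}" and nz: "nz N \<phi> k j"
  shows "BT N a k (denr N \<phi> d\<phi> j) (denr N \<phi> d\<phi> j) > 0"
proof -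
  have j: "j \<le> N" using nz by (simp add: nz_def T2_le)
  have "BT N a k (denr N \<phi> d\<phi> j) (denr N \<phi> d\<phi> j) \<noteq> 0"
    using BT_eq_0_imp_negligible[OF k mesh_L2_denr[OF j]] denr_null_iff[OF k j] nz
    unfolding nz_def by blast
  then show ?thesis using BT_nonneg[OF k mesh_L2_denr[OF j]] by simp
qed

text \<open>\<open>assoc\<close> tests energies and \<open>nz\<close> tests values. An entry of
  \<open>belem\<close> is zero by definition without \<open>nz\<close>; with \<open>nz\<close> its
  diagonal entry is positive by definiteness.\<close>

lemma assoc_eq:
  assumes k: "k \<in> {1..N}"
  shows "assoc N a \<phi> d\<phi> k = {l \<in> {1, 2}. nz N \<phi> k (k + l - 2)}"
  unfolding assoc_def belem_def using BT_nz_pos[OF k] by auto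

lemma enriched_iff: "enriched N a \<phi> d\<phi> k \<longleftrightarrow> assoc N a \<phi> d\<phi> k \<noteq> {}"
  unfolding enriched_def assoc_def by auto

text \<open>The summand receives both the local and the global index because \<delta> is indexed by
  local vertices and the coefficients by nodes.\<close>

lemma sum_assoc_eq:
  assumes k: "k \<in> {1..N}"
  shows "(\<Sum>l\<in>assoc N a \<phi> d\<phi> k. f l (k + l - 2)) = (\<Sum>j | nz N \<phi> k j. f (lidx j k) j)"
proof (rule sum.reindex_bij_witness[of _ "\<lambda>j. lidx j k" "\<lambda>l. k + l - 2"])
  fix l assume "l \<in> assoc N a \<phi> d\<phi> k"
  then have l: "l = 1 \<or> l = 2" "nz N \<phi> k (k + l - 2)" by (auto simp: assoc_eq[OF k])
  then show 1: "lidx (k + l - 2) k = l" using k by (auto simp: lidx_def)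
  show "k + l - 2 \<in> {j. nz N \<phi> k j}" using l by simp
  show "f (lidx (k + l - 2) k) (k + l - 2) = f l (k + l - 2)" by (simp only: 1)
next
  fix j assume "j \<in> {j. nz N \<phi> k j}"
  then have nz: "nz N \<phi> k j" by simp
  then show *: "k + lidx j k - 2 = j"
    using nz_imp_adjacent[OF k nz] by (auto simp: lidx_def)
  show "lidx j k \<in> assoc N a \<phi> d\<phi> k"
    using nz by (simp add: assoc_eq[OF k] *) (simp add: lidx_def)
qed

text \<open>If the enrichment at node i is nonzero on an element, then that node is an associated
  vertex, and this makes the element enriched.\<close>

lemma Kstar_eq:
  assumes i: "i \<in> T2 N \<phi>"
  shows "Kstar N a \<phi> d\<phi> i = {k \<in> {1..N}. nz N \<phi> k i}"
proof (intro equalityI subsetI)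
  fix k assume "k \<in> Kstar N a \<phi> d\<phi> i"
  then show "k \<in> {k \<in> {1..N}. nz N \<phi> k i}" using i by (simp add: Kstar_def nz_def)
next
  fix k assume "k \<in> {k \<in> {1..N}. nz N \<phi> k i}"
  then have k: "k \<in> {1..N}" and nz: "nz N \<phi> k i" by auto
  have adj: "i = k \<or> i + 1 = k" by (rule nz_imp_adjacent[OF k nz])
  then have "k + lidx i k - 2 = i" by (auto simp: lidx_def)
  then have "lidx i k \<in> assoc N a \<phi> d\<phi> k"
    using nz by (simp add: assoc_eq[OF k]) (simp add: lidx_def)
  then have "enriched N a \<phi> d\<phi> k" unfolding enriched_iff by blast
  then show "k \<in> Kstar N a \<phi> d\<phi> i" using k nz adj by (auto simp: Kstar_def nz_def)
qed

lemma BT_enriched_eq: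
  fixes d :: "nat \<Rightarrow> real"
  assumes k: "k \<in> {1..N}"
  defines "v \<equiv> \<lambda>x. \<Sum>j\<in>T2 N \<phi>. d j * denr N \<phi> d\<phi> j x"
  shows "BT N a k v v = (\<Sum>l\<in>assoc N a \<phi> d\<phi> k. \<Sum>m\<in>assoc N a \<phi> d\<phi> k.
    d (k + l - 2) * belem N a \<phi> d\<phi> k l m * d (k + m - 2))"
proof -
  let ?b = "\<lambda>i j. d i * BT N a k (denr N \<phi> d\<phi> i) (denr N \<phi> d\<phi> j) * d j"
  let ?J = "{j. nz N \<phi> k j}"
  have J: "?J \<subseteq> T2 N \<phi>" by (auto simp: nz_def)
  have "BT N a k v v = (\<Sum>i\<in>T2 N \<phi>. \<Sum>j\<in>T2 N \<phi>. ?b i j)"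
    unfolding v_def by (rule BT_sum_sum[OF k mesh_L2_denr[OF T2_le] finite_T2])
  also have "\<dots> = (\<Sum>i\<in>?J. \<Sum>j\<in>T2 N \<phi>. ?b i j)"
    by (rule sum.mono_neutral_right[OF finite_T2 J]) (auto simp: BT_not_nz[OF k])
  also have "\<dots> = (\<Sum>i\<in>?J. \<Sum>j\<in>?J. ?b i j)"
    by (intro sum.cong refl sum.mono_neutral_right[OF finite_T2 J]) (auto simp: BT_not_nz[OF k])
  also have "\<dots> = (\<Sum>l\<in>assoc N a \<phi> d\<phi> k. \<Sum>m\<in>assoc N a \<phi> d\<phi> k. ?b (k + l - 2) (k + m - 2))"
    using sum_assoc_eq[OF k, of "\<lambda>l i. \<Sum>m\<in>assoc N a \<phi> d\<phi> k. ?b i (k + m - 2)"]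
      sum_assoc_eq[OF k, of "\<lambda>m. ?b i" for i] by simp
  also have "\<dots> = (\<Sum>l\<in>assoc N a \<phi> d\<phi> k. \<Sum>m\<in>assoc N a \<phi> d\<phi> k.
    d (k + l - 2) * belem N a \<phi> d\<phi> k l m * d (k + m - 2))"
    by (intro sum.cong refl) (auto simp: belem_def assoc_eq[OF k])
  finally show ?thesis .
qed

text \<open>Exchanging the sums over elements and nodes collects, for each node, the weights of the
  elements on which its enrichment is active, which are those of \<open>Kstar\<close>.\<close>

lemma sum_assoc_Delta:
  "(\<Sum>k=1..N. \<Sum>l\<in>assoc N a \<phi> d\<phi> k. (d (k + l - 2) / \<delta> k l)\<^sup>2)
     = (\<Sum>j\<in>T2 N \<phi>. (d j)\<^sup>2 * Delta N a \<phi> d\<phi> \<delta> j)"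
proof -
  have "(\<Sum>k=1..N. \<Sum>l\<in>assoc N a \<phi> d\<phi> k. (d (k + l - 2) / \<delta> k l)\<^sup>2)
      = (\<Sum>k=1..N. \<Sum>j | j \<in> T2 N \<phi> \<and> nz N \<phi> k j. (d j / \<delta> k (lidx j k))\<^sup>2)"
  proof (rule sum.cong[OF refl])
    fix k assume k: "k \<in> {1..N}"
    have "{j. nz N \<phi> k j} = {j. j \<in> T2 N \<phi> \<and> nz N \<phi> k j}" by (auto simp: nz_def)
    then show "(\<Sum>l\<in>assoc N a \<phi> d\<phi> k. (d (k + l - 2) / \<delta> k l)\<^sup>2)
        = (\<Sum>j | j \<in> T2 N \<phi> \<and> nz N \<phi> k j. (d j / \<delta> k (lidx j k))\<^sup>2)"
      using sum_assoc_eq[OF k, of "\<lambda>l j. (d j / \<delta> k l)\<^sup>2"] by simp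
  qed
  also have "\<dots> = (\<Sum>j\<in>T2 N \<phi>. \<Sum>k | k \<in> {1..N} \<and> nz N \<phi> k j. (d j / \<delta> k (lidx j k))\<^sup>2)"
    by (rule sum.swap_restrict) (auto simp: finite_T2)
  also have "\<dots> = (\<Sum>j\<in>T2 N \<phi>. (d j)\<^sup>2 * Delta N a \<phi> d\<phi> \<delta> j)"
    unfolding Delta_def sum_distrib_left
    by (intro sum.cong refl) (auto simp: Kstar_eq power_divide)
  finally show ?thesis .
qed

lemma hat_combination_element:
  assumes k: "k \<in> {1..N}" and x: "node N (k - 1) < x" "x < node N k"
  shows "(\<Sum>i\<in>{1..N}. c i * dhat N i x) = real N * (c k - (if k = 1 then 0 else c (k - 1)))"
proof -
  have "(\<Sum>i\<in>{1..N}. c i * dhat N i x)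
    = (\<Sum>i\<in>{1..N}. (if i = k then real N * c k else 0)
        - (if i = k - 1 then real N * c (k - 1) else 0))"
    using k by (intro sum.cong refl) (auto simp: dhat_element[OF k x])
  \<comment> \<open>For k = 1 the second indicator would need i = 0, outside {1..N}: no hat function
    is attached to x_0, so the nodal value there is 0.\<close>
  also have "\<dots> = real N * c k - (if k = 1 then 0 else real N * c (k - 1))"
    using k by (auto simp: sum_subtractf)
  finally show ?thesis by (cases "k = 1") (simp_all add: right_diff_distrib)
qed

text \<open>Zero energy forces zero slope on every element, so all nodal values equal the one at
  x_0, which is 0.\<close>

lemma hat_combination_energy_pos:
  fixes c :: "nat \<Rightarrow> real"
  assumes i: "i \<in> {1..N}" "c i \<noteq> 0"
  defines "v \<equiv> \<lambda>x. \<Sum>i\<in>{1..N}. c i * dhat N i x"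
  shows "Bf a v v > 0"
proof (rule ccontr)
  assume "\<not> Bf a v v > 0"
  have v: "mesh_L2 v" unfolding v_def by (intro mesh_L2_sum mesh_L2_dhat)
  then have "(\<Sum>k=1..N. BT N a k v v) = 0"
    using Bf_nonneg[OF v] \<open>\<not> Bf a v v > 0\<close> by (simp add: Bf_eq_sum_BT)
  then have BT0: "BT N a k v v = 0" if "k \<in> {1..N}" for k
    using that BT_nonneg[OF _ v] by (subst (asm) sum_nonneg_eq_0_iff) auto
  have step: "c k = (if k = 1 then 0 else c (k - 1))" if k: "k \<in> {1..N}" for k
  proof (rule ccontr)
    assume ne: "c k \<noteq> (if k = 1 then 0 else c (k - 1))"
    have "negligible {x \<in> {node N (k - 1)..node N k}. v x \<noteq> 0}"
      by (rule BT_eq_0_imp_negligible[OF k v BT0[OF k]])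
    then have "negligible {node N (k - 1)<..<node N k}"
    proof (rule negligible_subset, intro subsetI)
      fix x assume x: "x \<in> {node N (k - 1)<..<node N k}"
      then have "v x = real N * (c k - (if k = 1 then 0 else c (k - 1)))"
        unfolding v_def by (intro hat_combination_element[OF k]) auto
      then have "v x \<noteq> 0" using ne Npos by simp
      then show "x \<in> {x \<in> {node N (k - 1)..node N k}. v x \<noteq> 0}" using x by simp
    qed
    then have "{node N (k - 1)<..<node N k} = {}"
      using open_not_negligible[OF open_greaterThanLessThan] by blast
    moreover have "node N (k - 1) < node N k" unfolding node_less_iff using k by simp
    ultimately show False by (metis dense empty_iff greaterThanLessThan_iff)
  qed
  have "c k = 0" if "k \<in> {1..N}" for k
    using that
  proof (induction k)
    case (Suc k)
    then show ?case using step[of "Suc k"] by (cases "k = 0") auto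
  qed simp
  then show False using i by blast
qed

lemma qform_Gram:
  assumes "\<And>p. p < n \<Longrightarrow> mesh_L2 (e p)"
  shows "qform (mat n n (\<lambda>(p, q). Bf a (e p) (e q))) y
    = Bf a (\<lambda>x. \<Sum>p<n. y p * e p x) (\<lambda>x. \<Sum>p<n. y p * e p x)"
proof -
  have "Bf a (\<lambda>x. \<Sum>p<n. y p * e p x) (\<lambda>x. \<Sum>p<n. y p * e p x)
    = (\<Sum>p<n. \<Sum>q<n. y p * Bf a (e p) (e q) * y q)"
    using assms by (intro Bf_sum_sum) auto
  then show ?thesis by (simp add: qform_def)
qed

lemma qform_A11:
  "qform (A11 N a) y = Bf a (\<lambda>x. \<Sum>i\<in>{1..N}. y (i - 1) * dhat N i x)
     (\<lambda>x. \<Sum>i\<in>{1..N}. y (i - 1) * dhat N i x)"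
proof -
  have "(\<Sum>i\<in>{1..N}. y (i - 1) * dhat N i x) = (\<Sum>p<N. y p * dhat N (p + 1) x)" for x
    by (rule sum.reindex_bij_witness[of _ "\<lambda>p. p + 1" "\<lambda>i. i - 1"]) auto
  then show ?thesis
    using qform_Gram[of N "\<lambda>p. dhat N (p + 1)" y] by (simp add: A11_def mesh_L2_dhat)
qed

lemma A11_carrier: "A11 N a \<in> carrier_mat N N"
  by (simp add: A11_def)

lemma Amat_carrier: "Amat N a \<phi> d\<phi> \<in> carrier_mat (N + card (T2 N \<phi>)) (N + card (T2 N \<phi>))"
  by (simp add: Amat_def)

lemma A11_diag_pos:
  assumes p: "p < N"
  shows "A11 N a $$ (p, p) > 0"
proof -
  define c :: "nat \<Rightarrow> real" where "c i = (if i = p + 1 then 1 else 0)" for i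
  have "(\<Sum>i\<in>{1..N}. c i * dhat N i x) = dhat N (p + 1) x" for x
    using p by (simp add: c_def if_distrib[of "\<lambda>t. t * _"] cong: if_cong)
  then show ?thesis
    using hat_combination_energy_pos[of "p + 1" c] p by (simp add: c_def A11_def)
qed

lemma scaled_A11_sym:
  assumes "i < N" "j < N"
  shows "scaled (A11 N a) $$ (i, j) = scaled (A11 N a) $$ (j, i)"
proof -
  have "A11 N a $$ (i, j) = A11 N a $$ (j, i)"
    using assms by (simp add: A11_def) (rule Bf_commute)
  then show ?thesis using assms by (simp add: scaled_index[OF A11_carrier] mult.commute)
qed

lemma scaled_Amat_sym:
  assumes "i < N + card (T2 N \<phi>)" "j < N + card (T2 N \<phi>)"
  shows "scaled (Amat N a \<phi> d\<phi>) $$ (i, j) = scaled (Amat N a \<phi> d\<phi>) $$ (j, i)"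
proof -
  have "Amat N a \<phi> d\<phi> $$ (i, j) = Amat N a \<phi> d\<phi> $$ (j, i)"
    using assms by (simp add: Amat_def) (rule Bf_commute)
  then show ?thesis using assms by (simp add: scaled_index[OF Amat_carrier] mult.commute)
qed

text \<open>The minimum is attained at a nonzero vector, and scaling by a positive diagonal keeps it
  nonzero, so the energy there is positive. This justifies dividing by \<open>lam_min\<close> in the
  final bound.\<close>

lemma lam_min_scaled_A11_pos: "lam_min (scaled (A11 N a)) > 0"
proof -
  let ?M = "scaled (A11 N a)"
  have n: "N > 0" using N by simp
  obtain x where x: "sqsum N x > 0" "qform ?M x = lam_min ?M * sqsum N x"
    using Rayleigh_min(2)[OF scaled_carrier[OF A11_carrier] n scaled_A11_sym] by auto
  then obtain p where p: "p < N" "x p \<noteq> 0"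
    using sqsum_eq_0_iff[of N x] by auto
  have "qform ?M x > 0"
    unfolding qform_scaled[OF A11_carrier] qform_A11
    by (rule hat_combination_energy_pos[of "p + 1"]) (use p A11_diag_pos[OF p(1)] in auto)
  then show ?thesis using x by (simp add: zero_less_mult_iff)
qed

end

section \<open>The scaled stiffness matrix\<close>

text \<open>Since \<open>Bf\<close> acts on derivatives, the two spaces in (i) are parametrized by
  coefficient vectors \<open>c\<close> and \<open>d\<close>. In (ii) the vector \<open>x\<close> is
  indexed by associated local vertices.\<close>

locale enriched_system = enriched_mesh +
  fixes \<delta> :: "nat \<Rightarrow> nat \<Rightarrow> real" and L1 U1 L2 U2 L3 U3 :: real
  assumes pos_const: "0 < L1" "0 < U1" "0 < L2" "0 < U2" "0 < L3" "0 < U3"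
    and stable_splitting: "\<And>c d :: nat \<Rightarrow> real.
        let v1 = (\<lambda>x. \<Sum>i\<in>{1..N}. c i * dhat N i x);
            v2 = (\<lambda>x. \<Sum>j\<in>T2 N \<phi>. d j * denr N \<phi> d\<phi> j x);
            v = (\<lambda>x. v1 x + v2 x)
        in L1 * (Bf a v1 v1 + Bf a v2 v2) \<le> \<bar>Bf a v v\<bar> \<and>
           \<bar>Bf a v v\<bar> \<le> U1 * (Bf a v1 v1 + Bf a v2 v2)"
    and element_bounds: "\<And>k x. 1 \<le> k \<Longrightarrow> k \<le> N \<Longrightarrow> enriched N a \<phi> d\<phi> k \<Longrightarrow>
        L2 * (\<Sum>l\<in>assoc N a \<phi> d\<phi> k. (x l / \<delta> k l)\<^sup>2)
          \<le> (\<Sum>l\<in>assoc N a \<phi> d\<phi> k. \<Sum>m\<in>assoc N a \<phi> d\<phi> k. x l * belem N a \<phi> d\<phi> k l m * x m) \<and>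
        (\<Sum>l\<in>assoc N a \<phi> d\<phi> k. \<Sum>m\<in>assoc N a \<phi> d\<phi> k. x l * belem N a \<phi> d\<phi> k l m * x m)
          \<le> U2 * (\<Sum>l\<in>assoc N a \<phi> d\<phi> k. (x l / \<delta> k l)\<^sup>2)"
    and diagonal_bounds: "\<And>i. i \<in> T2 N \<phi> \<Longrightarrow>
        L3 \<le> Delta N a \<phi> d\<phi> \<delta> i / Bf a (denr N \<phi> d\<phi> i) (denr N \<phi> d\<phi> i) \<and>
        Delta N a \<phi> d\<phi> \<delta> i / Bf a (denr N \<phi> d\<phi> i) (denr N \<phi> d\<phi> i) \<le> U3"

context enriched_system
begin

lemma enriched_block_bounds:
  fixes d :: "nat \<Rightarrow> real"
  defines "v \<equiv> \<lambda>x. \<Sum>j\<in>T2 N \<phi>. d j * denr N \<phi> d\<phi> j x"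
    and "S \<equiv> \<Sum>j\<in>T2 N \<phi>. (d j)\<^sup>2 * Delta N a \<phi> d\<phi> \<delta> j"
  shows "L2 * S \<le> Bf a v v" "Bf a v v \<le> U2 * S"
proof -
  have v: "mesh_L2 v" unfolding v_def by (intro mesh_L2_sum mesh_L2_denr T2_le)
  define E where "E k = (\<Sum>l\<in>assoc N a \<phi> d\<phi> k. (d (k + l - 2) / \<delta> k l)\<^sup>2)" for k
  have SE: "S = (\<Sum>k=1..N. E k)"
    unfolding S_def E_def by (rule sum_assoc_Delta[symmetric])
  have bd: "L2 * E k \<le> BT N a k v v \<and> BT N a k v v \<le> U2 * E k" if k: "k \<in> {1..N}" for k
  proof (cases "enriched N a \<phi> d\<phi> k")
    case True
    show ?thesis
      using element_bounds[OF _ _ True, of "\<lambda>l. d (k + l - 2)"] k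
      unfolding v_def BT_enriched_eq[OF k] E_def by simp
  next
    \<comment> \<open>Without associated vertices all local sums are empty, so the element carries
      no enrichment energy.\<close>
    case False
    then show ?thesis
      unfolding v_def BT_enriched_eq[OF k] E_def by (simp add: enriched_iff)
  qed
  show "L2 * S \<le> Bf a v v" "Bf a v v \<le> U2 * S"
    unfolding SE Bf_eq_sum_BT[OF v v] sum_distrib_left using bd by (auto intro!: sum_mono)
qed

text \<open>A zero denominator would make the quotient in (iii) equal to 0 by the convention for
  division, contradicting 0 < L3.\<close>

lemma denr_energy_pos:
  assumes j: "j \<in> T2 N \<phi>"
  shows "Bf a (denr N \<phi> d\<phi> j) (denr N \<phi> d\<phi> j) > 0"
proof -
  let ?b = "Bf a (denr N \<phi> d\<phi> j) (denr N \<phi> d\<phi> j)"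
  have "?b \<noteq> 0" using diagonal_bounds[OF j] pos_const(5) by auto
  moreover have "0 \<le> ?b" by (intro Bf_nonneg mesh_L2_denr T2_le j)
  ultimately show ?thesis by linarith
qed

text \<open>Stated for an arbitrary coordinate vector so that it applies to extremal vectors of the
  large scaled matrix and to zero-padded ones of the scaled A11.\<close>

lemma scaled_Amat_bounds:
  fixes x :: "nat \<Rightarrow> real"
  defines "q1 \<equiv> qform (scaled (A11 N a)) x"
    and "S \<equiv> sqsum (card (T2 N \<phi>)) (\<lambda>q. x (N + q))"
    and "Q \<equiv> qform (scaled (Amat N a \<phi> d\<phi>)) x"
  shows "L1 * (q1 + L2 * L3 * S) \<le> Q" "Q \<le> U1 * (q1 + U2 * U3 * S)"
proof -
  define m where "m = card (T2 N \<phi>)"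
  define s where "s = sorted_list_of_set (T2 N \<phi>)"
  define A where "A = Amat N a \<phi> d\<phi>"
  define e where "e = basisd N \<phi> d\<phi>"
  define y where "y p = x p / sqrt (A $$ (p, p))" for p
  have bij: "bij_betw ((!) s) {..<m} (T2 N \<phi>)"
    unfolding s_def m_def by (rule bij_betw_nth) (auto simp: finite_T2)
  \<comment> \<open>Enrichment columns follow the sorted list of \<open>T2\<close>;
    \<open>idx\<close> inverts this enumeration, so coefficients can be indexed by nodes as in the
    hypotheses.\<close>
  define idx where "idx = the_inv_into {..<m} ((!) s)"
  have idx: "idx (s ! q) = q" if "q < m" for q
    using that bij unfolding idx_def bij_betw_def by (auto intro: the_inv_into_f_f)
  define c where "c i = y (i - 1)" for i
  define d where "d j = y (N + idx j)" for j
  define v1 where "v1 = (\<lambda>x. \<Sum>i\<in>{1..N}. c i * dhat N i x)"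
  define v2 where "v2 = (\<lambda>x. \<Sum>j\<in>T2 N \<phi>. d j * denr N \<phi> d\<phi> j x)"
  have e1: "e p = dhat N (p + 1)" if "p < N" for p using that by (simp add: e_def basisd_def)
  have e2: "e (N + q) = denr N \<phi> d\<phi> (s ! q)" for q by (simp add: e_def basisd_def s_def)
  have sT: "s ! q \<in> T2 N \<phi>" if "q < m" for q using bij that by (auto simp: bij_betw_def)
  have eL2: "mesh_L2 (e p)" if "p < N + m" for p
  proof (cases "p < N")
    case True
    then show ?thesis by (simp add: e1 mesh_L2_dhat)
  next
    case False
    then have "e p = denr N \<phi> d\<phi> (s ! (p - N))" using e2[of "p - N"] by simp
    then show ?thesis using sT[of "p - N"] False that by (simp add: mesh_L2_denr T2_le)
  qed
  have AG: "A = mat (N + m) (N + m) (\<lambda>(p, q). Bf a (e p) (e q))"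
    by (simp add: A_def Amat_def e_def m_def)
  \<comment> \<open>Equal diagonals on the first N coordinates make the scaling of the large matrix
    act on v1 exactly as the scaling of A11.\<close>
  have A1: "A $$ (p, p) = A11 N a $$ (p, p)" if "p < N" for p
    using that by (simp add: AG A11_def e1)
  have A2: "A $$ (N + q, N + q) = Bf a (denr N \<phi> d\<phi> (s ! q)) (denr N \<phi> d\<phi> (s ! q))" if "q < m" for q
    using that by (simp add: AG e2)
  have split: "(\<Sum>p<N + m. y p * e p t) = v1 t + v2 t" for t
  proof -
    have "(\<Sum>p<N. y p * e p t) = v1 t"
      unfolding v1_def c_def
      by (rule sum.reindex_bij_witness[of _ "\<lambda>i. i - 1" "\<lambda>p. p + 1"]) (auto simp: e1)
    moreover have "(\<Sum>q<m. y (N + q) * e (N + q) t) = v2 t"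
      unfolding v2_def sum.reindex_bij_betw[OF bij, symmetric]
      by (intro sum.cong refl) (simp add: d_def idx e2)
    ultimately show ?thesis by (simp add: sum_lessThan_add)
  qed
  have Q: "Q = Bf a (\<lambda>x. v1 x + v2 x) (\<lambda>x. v1 x + v2 x)"
  proof -
    have "Q = qform A y"
      unfolding Q_def y_def A_def by (rule qform_scaled[OF Amat_carrier])
    also have "\<dots> = Bf a (\<lambda>x. \<Sum>p<N + m. y p * e p x) (\<lambda>x. \<Sum>p<N + m. y p * e p x)"
      unfolding AG by (rule qform_Gram[OF eL2])
    finally show ?thesis unfolding split .
  qed
  have q1: "q1 = Bf a v1 v1"
  proof -
    have "q1 = qform (A11 N a) y"
      unfolding q1_def qform_scaled[OF A11_carrier] y_def
      by (rule qform_cong) (simp add: A1 A11_def[THEN arg_cong, of dim_row])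
    then show ?thesis unfolding qform_A11 v1_def c_def .
  qed
  have v1: "mesh_L2 v1" unfolding v1_def by (intro mesh_L2_sum mesh_L2_dhat)
  have v2: "mesh_L2 v2" unfolding v2_def by (intro mesh_L2_sum mesh_L2_denr T2_le)
  \<comment> \<open>Nonnegativity removes the absolute value in the splitting hypothesis.\<close>
  have "0 \<le> Q" unfolding Q by (intro Bf_nonneg mesh_L2_add v1 v2)
  then have hyp: "L1 * (q1 + Bf a v2 v2) \<le> Q" "Q \<le> U1 * (q1 + Bf a v2 v2)"
    using stable_splitting[of c d] unfolding q1 Q v1_def v2_def Let_def by auto
  define W where "W = (\<Sum>j\<in>T2 N \<phi>. (d j)\<^sup>2 * Delta N a \<phi> d\<phi> \<delta> j)"
  \<comment> \<open>This is the ratio bounded in (iii): the square of a scaled coefficient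
    contributes the reciprocal of the diagonal entry.\<close>
  define r where "r j = Delta N a \<phi> d\<phi> \<delta> j / Bf a (denr N \<phi> d\<phi> j) (denr N \<phi> d\<phi> j)" for j
  have W: "W = (\<Sum>q<m. (x (N + q))\<^sup>2 * r (s ! q))"
    unfolding W_def sum.reindex_bij_betw[OF bij, symmetric]
  proof (intro sum.cong refl)
    fix q assume "q \<in> {..<m}"
    then have q: "q < m" by simp
    have "(d (s ! q))\<^sup>2 = (x (N + q))\<^sup>2 / Bf a (denr N \<phi> d\<phi> (s ! q)) (denr N \<phi> d\<phi> (s ! q))"
      using denr_energy_pos[OF sT[OF q]] by (simp add: d_def idx[OF q] y_def A2[OF q] power_divide)
    then show "(d (s ! q))\<^sup>2 * Delta N a \<phi> d\<phi> \<delta> (s ! q) = (x (N + q))\<^sup>2 * r (s ! q)"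
      by (simp add: r_def)
  qed
  have "L3 * S \<le> W" "W \<le> U3 * S"
    unfolding W S_def sqsum_def sum_distrib_left m_def[symmetric]
      mult.commute[of L3] mult.commute[of U3]
    using diagonal_bounds[OF sT]
    by (auto intro!: sum_mono mult_left_mono simp del: times_divide_eq_right simp: r_def)
  then have "L2 * (L3 * S) \<le> L2 * W" "U2 * W \<le> U2 * (U3 * S)"
    using pos_const by auto
  moreover have "L2 * W \<le> Bf a v2 v2" "Bf a v2 v2 \<le> U2 * W"
    unfolding W_def v2_def by (rule enriched_block_bounds)+
  ultimately have "q1 + L2 * L3 * S \<le> q1 + Bf a v2 v2" "q1 + Bf a v2 v2 \<le> q1 + U2 * U3 * S"
    by (simp_all add: mult.assoc)
  then have "L1 * (q1 + L2 * L3 * S) \<le> L1 * (q1 + Bf a v2 v2)"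
    "U1 * (q1 + Bf a v2 v2) \<le> U1 * (q1 + U2 * U3 * S)"
    using pos_const by auto
  then show "L1 * (q1 + L2 * L3 * S) \<le> Q" "Q \<le> U1 * (q1 + U2 * U3 * S)"
    using hyp by linarith+
qed

text \<open>Four eigenvalue comparisons suffice: \<open>low\<close> and \<open>up\<close> give the
  upper bound on the condition number, \<open>max_ge\<close> and \<open>min_le\<close> the lower
  one.\<close>

theorem kappa_bounds:
  "L1 / U1 * kappa (A11 N a) \<le> kappa (Amat N a \<phi> d\<phi>) \<and>
   kappa (Amat N a \<phi> d\<phi>) \<le> kappa (A11 N a) * (U1 / L1) *
     (max 1 (U2 * U3 / lam_max (scaled (A11 N a))) /
      min 1 (L2 * L3 / lam_min (scaled (A11 N a))))"
proof -
  define m where "m = card (T2 N \<phi>)"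
  define A where "A = scaled (Amat N a \<phi> d\<phi>)"
  define B where "B = scaled (A11 N a)"
  have n: "N > 0" "N + m > 0" using N by auto
  have Ac: "A \<in> carrier_mat (N + m) (N + m)"
    unfolding A_def m_def by (rule scaled_carrier[OF Amat_carrier])
  have Bc: "B \<in> carrier_mat N N"
    unfolding B_def by (rule scaled_carrier[OF A11_carrier])
  note symA = scaled_Amat_sym[folded m_def A_def] and symB = scaled_A11_sym[folded B_def]
  define tl where "tl x = (\<lambda>q. x (N + q))" for x :: "nat \<Rightarrow> real"
  have sq: "sqsum (N + m) x = sqsum N x + sqsum m (tl x)" for x
    by (simp add: sqsum_def sum_lessThan_add tl_def)
  have bounds: "L1 * (qform B x + L2 * L3 * sqsum m (tl x)) \<le> qform A x"
    "qform A x \<le> U1 * (qform B x + U2 * U3 * sqsum m (tl x))" for x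
    unfolding A_def B_def m_def tl_def by (rule scaled_Amat_bounds)+
  have lpos: "lam_min B > 0" unfolding B_def by (rule lam_min_scaled_A11_pos)
  have lmax: "lam_min B \<le> lam_max B"
  proof -
    obtain x where "sqsum N x > 0" "qform B x = lam_min B * sqsum N x"
      using Rayleigh_min(2)[OF Bc n(1) symB] by blast
    then show ?thesis using Rayleigh_max(1)[OF Bc n(1) symB, of x] by simp
  qed
  \<comment> \<open>The comparison forms q1 + L2 L3 S and q1 + U2 U3 S are block diagonal:
    \<open>mn\<close> bounds the first below by the worse of its blocks, \<open>mx\<close> bounds
    the second above likewise.\<close>
  define mn where "mn = min (lam_min B) (L2 * L3)"
  define mx where "mx = max (lam_max B) (U2 * U3)"
  have mnpos: "mn > 0" using lpos pos_const by (simp add: mn_def)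
  have low: "L1 * mn \<le> lam_min A"
  proof -
    obtain x where x: "sqsum (N + m) x > 0" "qform A x = lam_min A * sqsum (N + m) x"
      using Rayleigh_min(2)[OF Ac n(2) symA] by blast
    have "mn * sqsum N x \<le> lam_min B * sqsum N x"
      by (intro mult_right_mono sqsum_nonneg) (simp add: mn_def)
    also have "\<dots> \<le> qform B x" by (rule Rayleigh_min(1)[OF Bc n(1) symB])
    finally have "mn * sqsum N x \<le> qform B x" .
    moreover have "mn * sqsum m (tl x) \<le> L2 * L3 * sqsum m (tl x)"
      by (intro mult_right_mono sqsum_nonneg) (simp add: mn_def)
    ultimately have "mn * sqsum (N + m) x \<le> qform B x + L2 * L3 * sqsum m (tl x)"
      by (simp add: sq distrib_left)
    then have "L1 * (mn * sqsum (N + m) x) \<le> L1 * (qform B x + L2 * L3 * sqsum m (tl x))"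
      using pos_const by simp
    then have "L1 * mn * sqsum (N + m) x \<le> lam_min A * sqsum (N + m) x"
      using bounds(1)[of x] x(2) by (simp add: mult.assoc)
    then show ?thesis using x(1) by simp
  qed
  have up: "lam_max A \<le> U1 * mx"
  proof -
    obtain x where x: "sqsum (N + m) x > 0" "qform A x = lam_max A * sqsum (N + m) x"
      using Rayleigh_max(2)[OF Ac n(2) symA] by blast
    have "qform B x \<le> lam_max B * sqsum N x" by (rule Rayleigh_max(1)[OF Bc n(1) symB])
    also have "\<dots> \<le> mx * sqsum N x"
      by (intro mult_right_mono sqsum_nonneg) (simp add: mx_def)
    finally have "qform B x \<le> mx * sqsum N x" .
    moreover have "U2 * U3 * sqsum m (tl x) \<le> mx * sqsum m (tl x)"
      by (intro mult_right_mono sqsum_nonneg) (simp add: mx_def)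
    ultimately have "qform B x + U2 * U3 * sqsum m (tl x) \<le> mx * sqsum (N + m) x"
      by (simp add: sq distrib_left)
    then have "U1 * (qform B x + U2 * U3 * sqsum m (tl x)) \<le> U1 * (mx * sqsum (N + m) x)"
      using pos_const by simp
    then have "lam_max A * sqsum (N + m) x \<le> U1 * mx * sqsum (N + m) x"
      using bounds(2)[of x] x(2) by (simp add: mult.assoc)
    then show ?thesis using x(1) by simp
  qed
  \<comment> \<open>Test vectors without enrichment component: the tail vanishes and only the form
    of the scaled A11 remains in the bounds.\<close>
  define cut where "cut x p = (if p < N then x p else 0)" for x :: "nat \<Rightarrow> real" and p
  have cut: "sqsum (N + m) (cut x) = sqsum N x" "qform B (cut x) = qform B x"
    "sqsum m (tl (cut x)) = 0" for x
  proof -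
    show z: "sqsum m (tl (cut x)) = 0" by (simp add: sqsum_def tl_def cut_def)
    show "sqsum (N + m) (cut x) = sqsum N x" unfolding sq z by (simp add: sqsum_def cut_def)
    show "qform B (cut x) = qform B x" by (rule qform_cong) (use Bc in \<open>simp add: cut_def\<close>)
  qed
  have max_ge: "L1 * lam_max B \<le> lam_max A"
  proof -
    obtain x where x: "sqsum N x > 0" "qform B x = lam_max B * sqsum N x"
      using Rayleigh_max(2)[OF Bc n(1) symB] by blast
    have "L1 * lam_max B * sqsum N x \<le> lam_max A * sqsum N x"
      using bounds(1)[of "cut x"] Rayleigh_max(1)[OF Ac n(2) symA, of "cut x"] x(2)
      by (simp add: cut mult.assoc)
    then show ?thesis using x(1) by simp
  qed
  have min_le: "lam_min A \<le> U1 * lam_min B"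
  proof -
    obtain x where x: "sqsum N x > 0" "qform B x = lam_min B * sqsum N x"
      using Rayleigh_min(2)[OF Bc n(1) symB] by blast
    have "lam_min A * sqsum N x \<le> U1 * lam_min B * sqsum N x"
      using bounds(2)[of "cut x"] Rayleigh_min(1)[OF Ac n(2) symA, of "cut x"] x(2)
      by (simp add: cut mult.assoc)
    then show ?thesis using x(1) by simp
  qed
  have Lpos: "lam_max B > 0" using lpos lmax by linarith
  have Apos: "lam_min A > 0"
    using low mult_pos_pos[OF pos_const(1) mnpos] by linarith
  have "L1 / U1 * (lam_max B / lam_min B) = (L1 * lam_max B) / (U1 * lam_min B)" by simp
  also have "\<dots> \<le> lam_max A / lam_min A"
    using max_ge min_le Apos mult_pos_pos[OF pos_const(1) Lpos] by (intro frac_le) auto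
  finally have lower: "L1 / U1 * (lam_max B / lam_min B) \<le> lam_max A / lam_min A" .
  have "lam_max A / lam_min A \<le> (U1 * mx) / (L1 * mn)"
    using up low mnpos pos_const Lpos by (intro frac_le mult_pos_pos) (auto simp: mx_def)
  \<comment> \<open>Factoring the extreme eigenvalues of the scaled A11 out of \<open>mx\<close> and
    \<open>mn\<close> isolates its condition number and leaves the max and min of the claim.\<close>
  also have "mx = lam_max B * max 1 (U2 * U3 / lam_max B)"
    using Lpos by (simp add: mx_def max_mult_distrib_left)
  also have "mn = lam_min B * min 1 (L2 * L3 / lam_min B)"
    using lpos by (simp add: mn_def min_mult_distrib_left)
  finally have "lam_max A / lam_min A \<le> lam_max B / lam_min B * (U1 / L1) *
     (max 1 (U2 * U3 / lam_max B) / min 1 (L2 * L3 / lam_min B))"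
    by (simp add: mult_ac)
  then show ?thesis
    using lower unfolding kappa_def A_def[symmetric] B_def[symmetric] by blast
qed

end

theorem mainTheorem3:
  fixes N :: nat and a :: "real \<Rightarrow> real" and \<alpha> \<beta> :: real
    and \<phi> d\<phi> :: "nat \<Rightarrow> real \<Rightarrow> real" and \<delta> :: "nat \<Rightarrow> nat \<Rightarrow> real"
    and L1 U1 L2 U2 L3 U3 :: real
  assumes N: "N \<ge> 1"
    and a_meas: "a measurable_on {0..1}"
    and a_bnd: "0 < \<alpha>" "\<alpha> \<le> \<beta>" "\<forall>x. 0 < x \<and> x < 1 \<longrightarrow> \<alpha> \<le> a x \<and> a x \<le> \<beta>"
    and phi_H1: "\<forall>i\<le>N. H1_patch N \<phi> d\<phi> i"
    and delta: "\<forall>k. 1 \<le> k \<and> k \<le> N \<and> enriched N a \<phi> d\<phi> k \<longrightarrow>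
        (card (assoc N a \<phi> d\<phi> k) = 2 \<longrightarrow> \<delta> k 1 > 0 \<and> \<delta> k 2 > 0) \<and>
        (\<forall>l. assoc N a \<phi> d\<phi> k = {l} \<longrightarrow> \<delta> k l = 1 / sqrt (belem N a \<phi> d\<phi> k l l))"
    and pos_const: "0 < L1" "0 < U1" "0 < L2" "0 < U2" "0 < L3" "0 < U3"
    and hyp1: "\<forall>c d :: nat \<Rightarrow> real.
        let v1 = (\<lambda>x. \<Sum>i\<in>{1..N}. c i * dhat N i x);
            v2 = (\<lambda>x. \<Sum>j\<in>T2 N \<phi>. d j * denr N \<phi> d\<phi> j x);
            v = (\<lambda>x. v1 x + v2 x)
        in L1 * (Bf a v1 v1 + Bf a v2 v2) \<le> \<bar>Bf a v v\<bar> \<and>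
           \<bar>Bf a v v\<bar> \<le> U1 * (Bf a v1 v1 + Bf a v2 v2)"
    and hyp2: "\<forall>k. 1 \<le> k \<and> k \<le> N \<and> enriched N a \<phi> d\<phi> k \<longrightarrow> (\<forall>x :: nat \<Rightarrow> real.
        L2 * (\<Sum>l\<in>assoc N a \<phi> d\<phi> k. (x l / \<delta> k l)\<^sup>2)
          \<le> (\<Sum>l\<in>assoc N a \<phi> d\<phi> k. \<Sum>m\<in>assoc N a \<phi> d\<phi> k. x l * belem N a \<phi> d\<phi> k l m * x m) \<and>
        (\<Sum>l\<in>assoc N a \<phi> d\<phi> k. \<Sum>m\<in>assoc N a \<phi> d\<phi> k. x l * belem N a \<phi> d\<phi> k l m * x m)
          \<le> U2 * (\<Sum>l\<in>assoc N a \<phi> d\<phi> k. (x l / \<delta> k l)\<^sup>2))"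
    and hyp3: "\<forall>i\<in>T2 N \<phi>.
        L3 \<le> Delta N a \<phi> d\<phi> \<delta> i / Bf a (denr N \<phi> d\<phi> i) (denr N \<phi> d\<phi> i) \<and>
        Delta N a \<phi> d\<phi> \<delta> i / Bf a (denr N \<phi> d\<phi> i) (denr N \<phi> d\<phi> i) \<le> U3"
  shows "L1 / U1 * kappa (A11 N a) \<le> kappa (Amat N a \<phi> d\<phi>) \<and>
         kappa (Amat N a \<phi> d\<phi>) \<le> kappa (A11 N a) * (U1 / L1) *
            (max 1 (U2 * U3 / lam_max (scaled (A11 N a))) /
             min 1 (L2 * L3 / lam_min (scaled (A11 N a))))"
proof -
  interpret enriched_system N a \<alpha> \<beta> \<phi> d\<phi> \<delta> L1 U1 L2 U2 L3 U3
  proof (standard, goal_cases)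
    case (12 c d) then show ?case using hyp1 by blast
  next
    case (13 k x) then show ?case using hyp2 by blast
  next
    case (14 i) then show ?case using hyp3 by blast
  qed (use N a_meas a_bnd phi_H1 pos_const in auto)
  show ?thesis by (rule kappa_bounds)
qed

end
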